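(* Let $K:\mathbb{R}_+^3\to[0,\infty)$ be measurable with $K(x,y,z)=K(y,x,z)$ for all $x,y,z$ and $K(x,y,z)=0$ whenever $z>x$. Let $\alpha\ge0$, $\lambda\in[1,2]$, $\varphi\in Y_{-\alpha,\lambda}^+$, and assume $K(x,y,z)\le\hat x^{-\alpha}\hat y^{-\alpha}\check x^{\lambda}\check y^{\lambda}\varphi(z)$ for all $x,y,z\ge0$. If $\alpha>0$, assume in addition that there is a constant $C_\alpha>0$ with $$\widehat{(x-z)}^{-\alpha}K(x,y,z)\le C_\alpha\,\hat x^{-2\alpha}\hat y^{-\alpha}\check x^{\lambda}\check y^{\lambda}\varphi(z)\qquad\text{for all }x\ge z\ge0,\ y\ge0 .$$ Let $c_0\in Y_{-2\alpha,2\lambda}^+$ and $T\in(0,\infty]$. Then weak solutions of (CGEDG) on $[0,T)$ with initial datum $c_0$ are unique in $Y_{-2\alpha,2\lambda}^+$: if $c$ and $d$ are two weak solutions on $[0,T)$ with initial datum $c_0$ and parameters $(\beta,r)=(2\alpha,2\lambda)$, then $c_t=d_t$ a.e. for all $t\in[0,T)$.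
   Context: Notation: $\mathbb{R}_+=[0,\infty)$, $\hat x=\min(1,x)$, $\check x=\max(1,x)$, $\widehat{(x-z)}=\min(1,x-z)$. Conventions $0^{-\alpha}=+\infty$ for $\alpha>0$, $0\cdot\infty=0$. For $\beta,r\in\mathbb{R}$, $Y_{-\beta,r}=\{c\in L^1(\mathbb{R}_+):\|c\|_{-\beta,r}:=\int_0^\infty(x^{-\beta}+x^r)|c(x)|\,dx<\infty\}$, and $Y_{-\beta,r}^+$ is its cone of nonnegative elements. $Y_0=L^1(\mathbb{R}_+)$. Weak solution of the continuous generalized exchange-driven growth equation (CGEDG) with kernel $K$: let $T\in(0,\infty]$ and $c_0\in Y_{-\beta,r}^+$. A weak solution on $[0,T)$ with initial datum $c_0$ and parameters $(\beta,r)$ is a map $c:[0,T)\to Y_{-\beta,r}^+$, $t\mapsto c_t$, such that, with $\kappa[c_s](x,y,z):=K(x,y,z)c_s(x)c_s(y)$: (a) $c\in C([0,T),Y_0)\cap L^\infty([0,T),Y_{-\beta,r})$; (b) for all $t\in[0,T)$, $\int_0^t\int_0^\infty\int_0^\infty\int_0^\infty\kappa[c_s](x,y,z)\,dx\,dy\,dz\,ds<\infty$; (c) for all $t\in[0,T)$ and all $f\in L^\infty(\mathbb{R}_+)$, $\int_0^\infty f(x)[c_t(x)-c_0(x)]\,dx=\int_0^t\iiint_D(\Delta_zf)(x)\,\kappa[c_s](x,y,z)\,dz\,dx\,dy\,ds$, where $D=\{(x,y,z)\in\mathbb{R}_+^3:x\ge z,\ y\ge z\}$ and $(\Delta_zf)(x)=f(x+z)-2f(x)+f(x-z)$.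 *)

theory Defs
  imports "HOL-Analysis.Analysis"
begin

text \<open>
  Elements of \<open>L\<^sup>1\<close> and \<open>L\<^sup>\<infinity>\<close> on the half-line are represented by Lebesgue measurable functions,
  to be read up to equality almost everywhere. The values of such functions on the negative
  half-line never matter.
\<close>

abbreviation half_line :: "real measure" where
  "half_line \<equiv> lebesgue_on {0..}"

abbreviation octant :: "(real \<times> real \<times> real) measure" where
  "octant \<equiv> lebesgue_on ({0..} \<times> {0..} \<times> {0..})"

text \<open>\<open>Ynorm \<beta> r\<close>, \<open>Yspace \<beta> r\<close> and \<open>Ycone \<beta> r\<close> carry the indices \<open>(-\<beta>, r)\<close>. The weight at the
  single point \<open>x = 0\<close> is irrelevant for the integral.\<close>

definition Ynorm :: "real \<Rightarrow> real \<Rightarrow> (real \<Rightarrow> real) \<Rightarrow> ennreal" where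
  "Ynorm \<beta> r c = (\<integral>\<^sup>+x. ennreal ((x powr (-\<beta>) + x powr r) * \<bar>c x\<bar>) \<partial>half_line)"

definition Yspace :: "real \<Rightarrow> real \<Rightarrow> (real \<Rightarrow> real) set" where
  "Yspace \<beta> r = {c. integrable half_line c \<and> Ynorm \<beta> r c < \<infinity>}"

definition Ycone :: "real \<Rightarrow> real \<Rightarrow> (real \<Rightarrow> real) set" where
  "Ycone \<beta> r = {c \<in> Yspace \<beta> r. AE x in half_line. 0 \<le> c x}"

definition Linfty :: "(real \<Rightarrow> real) set" where
  "Linfty = {f \<in> borel_measurable half_line. \<exists>B. AE x in half_line. \<bar>f x\<bar> \<le> B}"

text \<open>\<open>neg_pow a x\<close> is \<open>x\<^sup>-\<^sup>a\<close> for \<open>a, x \<ge> 0\<close>, with \<open>0\<^sup>-\<^sup>a = \<infinity>\<close> for \<open>a > 0\<close> and \<open>0\<^sup>0 = 1\<close>, whereas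
  \<^const>\<open>powr\<close> would give \<open>0\<close> in both cases. The convention \<open>0 \<cdot> \<infinity> = 0\<close> is the one of
  \<^typ>\<open>ennreal\<close>.\<close>

definition neg_pow :: "real \<Rightarrow> real \<Rightarrow> ennreal" where
  "neg_pow a x = (if a = 0 then 1 else if x = 0 then \<infinity> else ennreal (x powr (-a)))"

definition hat :: "real \<Rightarrow> real" where
  "hat x = min 1 x"

definition check :: "real \<Rightarrow> real" where
  "check x = max 1 x"

definition kappa :: "(real \<Rightarrow> real \<Rightarrow> real \<Rightarrow> real) \<Rightarrow> (real \<Rightarrow> real) \<Rightarrow> real \<Rightarrow> real \<Rightarrow> real \<Rightarrow> real" where
  "kappa K c x y z = K x y z * c x * c y"

definition Delta :: "real \<Rightarrow> (real \<Rightarrow> real) \<Rightarrow> real \<Rightarrow> real" where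
  "Delta z f x = f (x + z) - 2 * f x + f (x - z)"

definition D :: "(real \<times> real \<times> real) set" where
  "D = {(x, y, z). 0 \<le> x \<and> 0 \<le> y \<and> 0 \<le> z \<and> x \<ge> z \<and> y \<ge> z}"

definition time_interval :: "ereal \<Rightarrow> real set" where
  "time_interval T = {t. 0 \<le> t \<and> ereal t < T}"

text \<open>
  Measurability of \<open>t \<mapsto> c t\<close> as a map into the weighted space, which is part of membership in
  \<open>L\<^sup>\<infinity>([0,T), Y)\<close>, is automatic: it follows from continuity in \<open>L\<^sup>1\<close> and \<open>c t \<in> Y\<close> for every \<open>t\<close>,
  because the weighted space is separable. The integration in time is kept outermost, so that
  everything depends only on the almost-everywhere classes of the individual \<open>c s\<close>.
  The initial datum is attained through the last clause at \<open>t = 0\<close>.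
\<close>

definition weak_solution ::
  "(real \<Rightarrow> real \<Rightarrow> real \<Rightarrow> real) \<Rightarrow> ereal \<Rightarrow> real \<Rightarrow> real \<Rightarrow> (real \<Rightarrow> real) \<Rightarrow> (real \<Rightarrow> real \<Rightarrow> real) \<Rightarrow> bool"
where
  "weak_solution K T \<beta> r c0 c \<longleftrightarrow>
     (\<forall>t\<in>time_interval T. c t \<in> Ycone \<beta> r) \<and>
     (\<forall>t\<in>time_interval T.
        ((\<lambda>s. LINT x|half_line. \<bar>c s x - c t x\<bar>) \<longlongrightarrow> 0) (at t within time_interval T)) \<and>
     (\<exists>B::real. AE t in lebesgue_on (time_interval T). Ynorm \<beta> r (c t) \<le> ennreal B) \<and>
     (\<forall>t\<in>time_interval T.
        (\<integral>\<^sup>+s. (\<integral>\<^sup>+(x, y, z). ennreal (kappa K (c s) x y z) \<partial>octant) \<partial>lebesgue_on {0..t}) < \<infinity>) \<and>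
     (\<forall>t\<in>time_interval T. \<forall>f\<in>Linfty.
        (LINT x|half_line. f x * (c t x - c0 x)) =
        (LINT s|lebesgue_on {0..t}.
           (LINT (x, y, z)|lebesgue_on D. Delta z f x * kappa K (c s) x y z)))"

end

theory Submission
  imports Defs
begin

text \<open>
  For two solutions put \<open>e = c - d\<close> and measure \<open>e\<close> with the weight
  \<open>w x = hat x powr -\<alpha> + x powr lam\<close>. Testing the weak formulation with \<open>w * sgn e\<close>, the change of
  \<open>\<integral> w |e|\<close> splits into a term with \<open>e\<close> in the variable \<open>x\<close>, where only the second difference of
  \<open>w\<close> matters, and a term with \<open>e\<close> in the variable \<open>y\<close>, where the values of \<open>w\<close> are paid for by the
  moment of order \<open>w\<^sup>2\<close> of \<open>d\<close>. Both are at most a constant times \<open>\<integral> w |e|\<close>, and Gronwall's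
  lemma gives \<open>e = 0\<close>. Admissible test functions are bounded and do not depend on time. Hence \<open>w\<close>
  is replaced by \<open>min w n\<close>, which does not increase the positive part of the second difference, and
  the sign is frozen at the end of a short time step. The error this causes is of lower order,
  because solutions are continuous in the \<open>w\<close>-weighted norm, by interpolation between continuity in
  \<open>L\<^sup>1\<close> and the bound on the \<open>w\<^sup>2\<close>-moment.
\<close>

section \<open>Tensor-product integrals, truncation limits and Gronwall's lemma\<close>

lemma integrable_lborel_mult_pair:
  fixes f :: "'a::euclidean_space \<Rightarrow> real" and g :: "'b::euclidean_space \<Rightarrow> real"
  assumes f: "integrable lborel f" and g: "integrable lborel g"
  shows "integrable lborel (\<lambda>(x, y). f x * g y)"
    and "(LINT (x, y)|lborel. f x * g y) = (LINT x|lborel. f x) * (LINT y|lborel. g y)"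
proof -
  note [measurable] = borel_measurable_integrable[OF f] borel_measurable_integrable[OF g]
  have I: "integrable (lborel \<Otimes>\<^sub>M lborel) (\<lambda>(x, y). f x * g y)"
  proof (rule lborel_pair.Fubini_integrable)
    show "(\<lambda>(x, y). f x * g y) \<in> borel_measurable (lborel \<Otimes>\<^sub>M lborel)" by measurable
    show "integrable lborel (\<lambda>x. LINT y|lborel. norm (case (x, y) of (x, y) \<Rightarrow> f x * g y))"
      using f by (simp add: abs_mult)
    show "AE x in lborel. integrable lborel (\<lambda>y. case (x, y) of (x, y) \<Rightarrow> f x * g y)"
      using g by simp
  qed
  then show "integrable lborel (\<lambda>(x, y). f x * g y)" by (simp add: lborel_prod)
  have "integral\<^sup>L (lborel \<Otimes>\<^sub>M lborel) (\<lambda>(x, y). f x * g y) = (LINT x|lborel. LINT y|lborel. f x * g y)"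
    using lborel_pair.integral_fst'[OF I] by simp
  then show "(LINT (x, y)|lborel. f x * g y) = (LINT x|lborel. f x) * (LINT y|lborel. g y)"
    by (simp add: lborel_prod)
qed

lemma integrable_lborel_mult_triple:
  fixes f g h :: "real \<Rightarrow> real"
  assumes f: "integrable lborel f" and g: "integrable lborel g" and h: "integrable lborel h"
  shows "integrable lborel (\<lambda>(x, y, z). f x * g y * h z)"
    and "(LINT (x, y, z)|lborel. f x * g y * h z)
      = (LINT x|lborel. f x) * (LINT x|lborel. g x) * (LINT x|lborel. h x)"
  using integrable_lborel_mult_pair[OF f integrable_lborel_mult_pair(1)[OF g h]]
    integrable_lborel_mult_pair(2)[OF g h]
  by (simp_all add: case_prod_unfold mult_ac)

text \<open>At each \<open>x\<close> the cap is inactive once \<open>n\<close> exceeds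
  \<open>v x\<close>, and \<open>v x * \<bar>e x\<bar>\<close> dominates. This removes the
  truncation of \<open>w\<close> in the uniqueness proof, and that of its square in the proof of
  lower semicontinuity.\<close>

lemma integral_truncated_weight_tendsto:
  fixes v e :: "real \<Rightarrow> real"
  assumes v [measurable]: "v \<in> borel_measurable borel" and v0: "\<And>x. 0 \<le> v x"
    and e [measurable]: "e \<in> borel_measurable borel" and I: "integrable lborel (\<lambda>x. v x * \<bar>e x\<bar>)"
  shows "(\<lambda>n. LINT x|lborel. min (v x) (real n) * \<bar>e x\<bar>) \<longlonglongrightarrow> (LINT x|lborel. v x * \<bar>e x\<bar>)"
proof (rule integral_dominated_convergence[OF _ _ I])
  show "(\<lambda>x. v x * \<bar>e x\<bar>) \<in> borel_measurable lborel"
    "(\<lambda>x. min (v x) (real n) * \<bar>e x\<bar>) \<in> borel_measurable lborel" for n by measurable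
  show "AE x in lborel. norm (min (v x) (real n) * \<bar>e x\<bar>) \<le> v x * \<bar>e x\<bar>" for n
    using v0 by (auto simp: abs_mult intro!: mult_right_mono)
  have "(\<lambda>n. min (v x) (real n) * \<bar>e x\<bar>) \<longlonglongrightarrow> v x * \<bar>e x\<bar>" for x
  proof (rule tendsto_eventually)
    obtain m where m: "v x \<le> real m" using real_arch_simple by blast
    show "\<forall>\<^sub>F n in sequentially. min (v x) (real n) * \<bar>e x\<bar> = v x * \<bar>e x\<bar>"
      using eventually_ge_at_top[of m] by eventually_elim (use m in simp)
  qed
  then show "AE x in lborel. (\<lambda>n. min (v x) (real n) * \<bar>e x\<bar>) \<longlonglongrightarrow> v x * \<bar>e x\<bar>" by simp
qed

text \<open>With \<open>J\<close> the primitive of \<open>N\<close>, the function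
  \<open>exp (- L * t) * J t\<close> has nonpositive derivative and vanishes at 0, so
  \<open>J \<le> 0\<close>. As \<open>N\<close> is nonnegative, \<open>J = 0\<close>, and the
  hypothesis bounds \<open>N\<close> by \<open>L * J\<close>. Continuity of \<open>N\<close> is what
  makes \<open>J\<close> differentiable.\<close>

lemma gronwall_zero:
  fixes N :: "real \<Rightarrow> real"
  assumes cont: "continuous_on {0..\<tau>} N"
    and le: "\<And>t. t \<in> {0..\<tau>} \<Longrightarrow> N t \<le> L * integral {0..t} N"
    and nonneg: "\<And>t. t \<in> {0..\<tau>} \<Longrightarrow> 0 \<le> N t" and L: "0 \<le> L" and t: "t \<in> {0..\<tau>}"
  shows "N t = 0"
proof -
  define J where "J = (\<lambda>t. integral {0..t} N)"
  define F where "F = (\<lambda>t. exp (- L * t) * J t)"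
  have dJ: "(J has_real_derivative N s) (at s within {0..\<tau>})" if "s \<in> {0..\<tau>}" for s
    unfolding J_def using integral_has_real_derivative[OF cont that] .
  have dF: "(F has_real_derivative exp (- L * s) * (N s - L * J s)) (at s within {0..\<tau>})"
    if "s \<in> {0..\<tau>}" for s
    unfolding F_def
    by (rule derivative_eq_intros dJ that refl | simp add: algebra_simps)+
  have J0: "0 \<le> J s" if "s \<in> {0..\<tau>}" for s
    unfolding J_def using that by (intro integral_nonneg integrable_continuous_real
      continuous_on_subset[OF cont] nonneg) auto
  have "F t \<le> F 0"
  proof (cases "t = 0")
    case False
    then have "0 < t" "t \<le> \<tau>" using t by auto
    show ?thesis
    proof (rule DERIV_nonpos_imp_decreasing_open[where f = F and a = 0 and b = t])
      show "continuous_on {0..t} F"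
        using t by (intro DERIV_continuous_on[OF DERIV_subset[OF dF]]) auto
      fix s assume s: "0 < s" "s < t"
      then have "(F has_real_derivative exp (- L * s) * (N s - L * J s)) (at s)"
        using dF[of s] t by (auto simp: at_within_Icc_at)
      moreover have "exp (- L * s) * (N s - L * J s) \<le> 0"
        using le[of s] s t by (auto simp: J_def mult_le_0_iff)
      ultimately show "\<exists>y. (F has_real_derivative y) (at s) \<and> y \<le> 0" by blast
    qed (use t in auto)
  qed simp
  then have "J t \<le> 0" by (simp add: F_def J_def mult_le_0_iff)
  then have "J t = 0" using J0[OF t] by simp
  then show ?thesis using le[OF t] nonneg[OF t] unfolding J_def by simp
qed

subsection \<open>Uniqueness for a kernel dominated by a weight\<close>

text \<open>Lets functions of triples be handled directly over \<open>borel\<close>, the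
  sigma-algebra of \<open>lborel\<close> on the product type.\<close>

lemma borel_measurable_fst_snd [measurable]:
  "fst \<in> borel_measurable (borel :: ('a::second_countable_topology \<times> 'b::second_countable_topology) measure)"
  "snd \<in> borel_measurable (borel :: ('a::second_countable_topology \<times> 'b::second_countable_topology) measure)"
  by (auto intro!: borel_measurable_continuous_onI continuous_intros)

text \<open>\<open>K_le\<close> makes the collision integral finite for bounded test functions and
  controls the error of freezing a sign. \<open>Delta_w_K_le\<close> treats a difference of
  solutions in the variable \<open>x\<close>; it is one-sided because a very negative second
  difference only helps. \<open>sum_w_K_le\<close> treats a difference in \<open>y\<close>, at the
  price of one more power of \<open>w x\<close>. The bounds hold almost everywhere so that
  \<open>K\<close> may be a Borel representative.\<close>

locale exchange_kernel =
  fixes K :: "real \<times> real \<times> real \<Rightarrow> real" and w \<Phi> :: "real \<Rightarrow> real"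
  assumes K_measurable [measurable]: "K \<in> borel_measurable borel"
    and K_nonneg: "0 \<le> K v"
    and w_measurable [measurable]: "w \<in> borel_measurable borel"
    and w_nonneg: "0 \<le> w x"
    and w_ge_1: "0 < x \<Longrightarrow> 1 \<le> w x"
    and \<Phi>_integrable: "integrable lborel \<Phi>"
    and \<Phi>_nonneg: "0 \<le> \<Phi> z"
    and K_le: "AE (x, y, z) in lborel. K (x, y, z) \<le> w x * w y * \<Phi> z"
    and Delta_w_K_le: "AE (x, y, z) in lborel. Delta z w x * K (x, y, z) \<le> w x * w y * \<Phi> z"
    and sum_w_K_le: "AE (x, y, z) in lborel.
      (w (x + z) + 2 * w x + w (x - z)) * K (x, y, z) \<le> (w x)\<^sup>2 * w y * \<Phi> z"
begin

text \<open>A Borel representative of a density, extended by zero. Vanishing for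
  \<open>x \<le> 0\<close> confines comparisons to points with \<open>1 \<le> w x\<close> and lets
  integrals run over the whole line.\<close>

definition admissible :: "(real \<Rightarrow> real) \<Rightarrow> bool" where
  "admissible p \<longleftrightarrow> p \<in> borel_measurable borel \<and> (\<forall>x\<le>0. p x = 0) \<and> integrable lborel (\<lambda>x. (w x)\<^sup>2 * \<bar>p x\<bar>)"

definition wnorm :: "(real \<Rightarrow> real) \<Rightarrow> real" where
  "wnorm p = (LINT x|lborel. w x * \<bar>p x\<bar>)"

definition w2norm :: "(real \<Rightarrow> real) \<Rightarrow> real" where
  "w2norm p = (LINT x|lborel. (w x)\<^sup>2 * \<bar>p x\<bar>)"

text \<open>For \<open>K\<close> supported in \<open>D\<close>, \<open>form f p p\<close> is the
  inner integral on the right of the weak formulation. Separate arguments for the two density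
  factors make it bilinear; the second difference acts only in the variable of
  \<open>p\<close>.\<close>

definition form :: "(real \<Rightarrow> real) \<Rightarrow> (real \<Rightarrow> real) \<Rightarrow> (real \<Rightarrow> real) \<Rightarrow> real" where
  "form f p q = (LINT (x, y, z)|lborel. Delta z f x * K (x, y, z) * p x * q y)"

section \<open>Weighted norms of admissible functions\<close>

lemma admissible_measurable: "admissible p \<Longrightarrow> p \<in> borel_measurable borel"
  by (simp add: admissible_def)

lemma admissible_le_w:
  assumes "admissible p"
  shows "\<bar>p x\<bar> \<le> w x * \<bar>p x\<bar>" and "w x * \<bar>p x\<bar> \<le> (w x)\<^sup>2 * \<bar>p x\<bar>"
proof -
  have "p x = 0 \<or> 1 \<le> w x" using assms w_ge_1[of x] by (cases "x \<le> 0") (auto simp: admissible_def)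
  then show "\<bar>p x\<bar> \<le> w x * \<bar>p x\<bar>" "w x * \<bar>p x\<bar> \<le> (w x)\<^sup>2 * \<bar>p x\<bar>"
    by (auto simp: mult_le_cancel_right1 power2_eq_square)
qed

lemma admissible_integrable:
  assumes p: "admissible p"
  shows "integrable lborel (\<lambda>x. (w x)\<^sup>2 * \<bar>p x\<bar>)" and "integrable lborel (\<lambda>x. w x * \<bar>p x\<bar>)"
    and "integrable lborel (\<lambda>x. \<bar>p x\<bar>)" and "integrable lborel p"
proof -
  note [measurable] = admissible_measurable[OF p]
  show I: "integrable lborel (\<lambda>x. (w x)\<^sup>2 * \<bar>p x\<bar>)" using p by (simp add: admissible_def)
  show J: "integrable lborel (\<lambda>x. w x * \<bar>p x\<bar>)"
    by (rule Bochner_Integration.integrable_bound[OF I])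
      (use admissible_le_w[OF p] w_nonneg in \<open>auto simp: abs_mult\<close>)
  show "integrable lborel (\<lambda>x. \<bar>p x\<bar>)"
    by (rule Bochner_Integration.integrable_bound[OF J])
      (use admissible_le_w[OF p] w_nonneg in \<open>auto simp: abs_mult\<close>)
  then show "integrable lborel p" by (subst (asm) integrable_abs_iff) auto
qed

lemma admissible_diff:
  assumes p: "admissible p" and q: "admissible q"
  shows "admissible (\<lambda>x. p x - q x)"
proof -
  note [measurable] = admissible_measurable[OF p] admissible_measurable[OF q]
  have "integrable lborel (\<lambda>x. (w x)\<^sup>2 * \<bar>p x\<bar> + (w x)\<^sup>2 * \<bar>q x\<bar>)"
    using admissible_integrable(1)[OF p] admissible_integrable(1)[OF q] by simp
  then have "integrable lborel (\<lambda>x. (w x)\<^sup>2 * \<bar>p x - q x\<bar>)"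
  proof (rule Bochner_Integration.integrable_bound)
    show "AE x in lborel. norm ((w x)\<^sup>2 * \<bar>p x - q x\<bar>) \<le> norm ((w x)\<^sup>2 * \<bar>p x\<bar> + (w x)\<^sup>2 * \<bar>q x\<bar>)"
      by (simp add: abs_mult flip: distrib_left) (auto intro!: mult_left_mono)
  qed measurable
  then show ?thesis using p q by (auto simp: admissible_def)
qed

lemma wnorm_nonneg: "0 \<le> wnorm p"
  unfolding wnorm_def by (intro Bochner_Integration.integral_nonneg) (simp add: w_nonneg)

lemma w2norm_nonneg: "0 \<le> w2norm p"
  unfolding w2norm_def by (intro Bochner_Integration.integral_nonneg) simp

lemma wnorm_le_w2norm: "admissible p \<Longrightarrow> wnorm p \<le> w2norm p"
  unfolding wnorm_def w2norm_def
  by (intro integral_mono admissible_integrable admissible_le_w)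

lemma w2norm_diff_le:
  assumes "admissible p" "admissible q"
  shows "w2norm (\<lambda>x. p x - q x) \<le> w2norm p + w2norm q"
proof -
  have "w2norm (\<lambda>x. p x - q x) \<le> (LINT x|lborel. (w x)\<^sup>2 * \<bar>p x\<bar> + (w x)\<^sup>2 * \<bar>q x\<bar>)"
    unfolding w2norm_def
  proof (intro integral_mono Bochner_Integration.integrable_add)
    show "(w x)\<^sup>2 * \<bar>p x - q x\<bar> \<le> (w x)\<^sup>2 * \<bar>p x\<bar> + (w x)\<^sup>2 * \<bar>q x\<bar>" for x
      by (simp flip: distrib_left) (auto intro!: mult_left_mono)
  qed (intro admissible_integrable admissible_diff assms)+
  then show ?thesis
    unfolding w2norm_def by (simp add: admissible_integrable assms)
qed

lemma wnorm_triangle: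
  assumes "admissible p" "admissible q" "admissible r"
  shows "wnorm (\<lambda>x. p x - r x) \<le> wnorm (\<lambda>x. p x - q x) + wnorm (\<lambda>x. q x - r x)"
proof -
  have "wnorm (\<lambda>x. p x - r x) \<le> (LINT x|lborel. w x * \<bar>p x - q x\<bar> + w x * \<bar>q x - r x\<bar>)"
    unfolding wnorm_def
  proof (intro integral_mono Bochner_Integration.integrable_add)
    show "w x * \<bar>p x - r x\<bar> \<le> w x * \<bar>p x - q x\<bar> + w x * \<bar>q x - r x\<bar>" for x
      by (simp flip: distrib_left) (auto intro!: mult_left_mono w_nonneg)
  qed (intro admissible_integrable admissible_diff assms)+
  then show ?thesis
    unfolding wnorm_def by (simp add: admissible_integrable admissible_diff assms)
qed

lemma wnorm_diff_commute: "wnorm (\<lambda>x. p x - q x) = wnorm (\<lambda>x. q x - p x)"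
  unfolding wnorm_def by (simp add: abs_minus_commute)

lemma abs_wnorm_diff_le:
  assumes "admissible p" "admissible q"
  shows "\<bar>wnorm p - wnorm q\<bar> \<le> wnorm (\<lambda>x. p x - q x)"
proof -
  have 0: "admissible (\<lambda>x. 0)" by (simp add: admissible_def)
  show ?thesis
    using wnorm_triangle[OF assms 0] wnorm_triangle[OF assms(2,1) 0] wnorm_diff_commute[of p q]
    by simp
qed

text \<open>Integrates the elementary bound \<open>u \<le> M + u^2 / M\<close> at
  \<open>u = w x\<close>. With a bounded \<open>w2norm\<close>, a large \<open>M\<close> makes the
  last term small, and then convergence in L^1 gives convergence in \<open>wnorm\<close>.\<close>

lemma wnorm_interpolation:
  assumes p: "admissible p" and M: "0 < M"
  shows "wnorm p \<le> M * (LINT x|lborel. \<bar>p x\<bar>) + w2norm p / M"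
proof -
  have *: "u \<le> M + u\<^sup>2 / M" if "0 \<le> u" for u
  proof -
    have "0 \<le> u * M" using M that by simp
    then have "u * M \<le> (M + u\<^sup>2 / M) * M"
      using M sum_squares_bound[of u M]
      by (simp add: distrib_right power2_eq_square)
    then show ?thesis using M by simp
  qed
  have "wnorm p \<le> (LINT x|lborel. M * \<bar>p x\<bar> + (w x)\<^sup>2 * \<bar>p x\<bar> / M)"
    unfolding wnorm_def
  proof (intro integral_mono admissible_integrable(1-3) p Bochner_Integration.integrable_add
      integrable_mult_right integrable_divide)
    show "w x * \<bar>p x\<bar> \<le> M * \<bar>p x\<bar> + (w x)\<^sup>2 * \<bar>p x\<bar> / M" for x
      using mult_right_mono[OF *[OF w_nonneg[of x]], of "\<bar>p x\<bar>"] by (simp add: algebra_simps)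
  qed
  then show ?thesis
    unfolding w2norm_def by (simp add: admissible_integrable p)
qed

section \<open>Estimates for the bilinear collision form\<close>

lemma form_integrand_measurable:
  assumes [measurable]: "f \<in> borel_measurable borel" "p \<in> borel_measurable borel" "q \<in> borel_measurable borel"
  shows "(\<lambda>(x, y, z). Delta z f x * K (x, y, z) * p x * q y) \<in> borel_measurable borel"
  unfolding Delta_def case_prod_unfold by measurable

text \<open>The second difference has coefficients 1, 2 and 1, hence the factor 4. With
  \<open>K_le\<close> the integrand is dominated by a product of functions of \<open>x\<close>,
  \<open>y\<close> and \<open>z\<close> separately, whose integral factorizes.\<close>

lemma form_integrable:
  assumes f: "f \<in> borel_measurable borel" and M: "\<And>x. \<bar>f x\<bar> \<le> M" and p: "admissible p" and q: "admissible q"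
  shows "integrable lborel (\<lambda>(x, y, z). Delta z f x * K (x, y, z) * p x * q y)"
    and "\<bar>form f p q\<bar> \<le> 4 * M * integral\<^sup>L lborel \<Phi> * wnorm p * wnorm q"
proof -
  have M0: "0 \<le> M" using M[of 0] by linarith
  have D: "\<bar>Delta z f x\<bar> \<le> 4 * M" for x z
    using M[of "x + z"] M[of x] M[of "x - z"] unfolding Delta_def by linarith
  note prod = integrable_lborel_mult_triple[OF integrable_mult_right[OF admissible_integrable(2)[OF p]]
      admissible_integrable(2)[OF q] \<Phi>_integrable, of "4 * M"]
  have le: "AE v in lborel. norm (case v of (x, y, z) \<Rightarrow> Delta z f x * K (x, y, z) * p x * q y)
      \<le> (case v of (x, y, z) \<Rightarrow> (4 * M * (w x * \<bar>p x\<bar>)) * (w y * \<bar>q y\<bar>) * \<Phi> z)"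
    using K_le
  proof eventually_elim
    case (elim v)
    obtain x y z where v: "v = (x, y, z)" by (cases v)
    have "\<bar>Delta z f x\<bar> * K (x, y, z) * (\<bar>p x\<bar> * \<bar>q y\<bar>) \<le> (4 * M) * (w x * w y * \<Phi> z) * (\<bar>p x\<bar> * \<bar>q y\<bar>)"
      using elim D[of z x] K_nonneg M0 unfolding v
      by (intro mult_right_mono mult_mono) auto
    then show ?case using K_nonneg by (simp add: v abs_mult mult_ac)
  qed
  show I: "integrable lborel (\<lambda>(x, y, z). Delta z f x * K (x, y, z) * p x * q y)"
    by (rule Bochner_Integration.integrable_bound[OF prod(1)])
      (use le form_integrand_measurable[OF f admissible_measurable[OF p] admissible_measurable[OF q]]
        in \<open>auto elim!: eventually_mono\<close>)
  have "\<bar>form f p q\<bar> \<le> (LINT v|lborel. norm (case v of (x, y, z) \<Rightarrow> Delta z f x * K (x, y, z) * p x * q y))"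
    unfolding form_def using integral_norm_bound[of lborel "\<lambda>(x, y, z). Delta z f x * K (x, y, z) * p x * q y"] by simp
  also have "\<dots> \<le> (LINT (x, y, z)|lborel. (4 * M * (w x * \<bar>p x\<bar>)) * (w y * \<bar>q y\<bar>) * \<Phi> z)"
    by (intro integral_mono_AE integrable_norm I prod(1) le)
  also have "\<dots> = 4 * M * integral\<^sup>L lborel \<Phi> * wnorm p * wnorm q"
    unfolding prod(2) wnorm_def integral_mult_right_zero by (simp add: mult_ac)
  finally show "\<bar>form f p q\<bar> \<le> 4 * M * integral\<^sup>L lborel \<Phi> * wnorm p * wnorm q" .
qed

text \<open>Adding and subtracting the mixed term \<open>q x * p y\<close> puts the difference once
  into the variable \<open>x\<close> and once into \<open>y\<close>. These two positions need
  different estimates, because the second difference involves \<open>x\<close> but not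
  \<open>y\<close>.\<close>

lemma form_diff:
  assumes f: "f \<in> borel_measurable borel" and M: "\<And>x. \<bar>f x\<bar> \<le> M" and p: "admissible p" and q: "admissible q"
  shows "form f p p - form f q q = form f (\<lambda>x. p x - q x) p + form f q (\<lambda>x. p x - q x)"
proof -
  note I = form_integrable(1)[OF f M]
  have "form f (\<lambda>x. p x - q x) p + form f q (\<lambda>x. p x - q x)
    = (LINT v|lborel. (case v of (x, y, z) \<Rightarrow> Delta z f x * K (x, y, z) * (p x - q x) * p y)
        + (case v of (x, y, z) \<Rightarrow> Delta z f x * K (x, y, z) * q x * (p y - q y)))"
    unfolding form_def by (intro Bochner_Integration.integral_add[symmetric] I p q admissible_diff)
  also have "\<dots> = (LINT v|lborel. (case v of (x, y, z) \<Rightarrow> Delta z f x * K (x, y, z) * p x * p y)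
        - (case v of (x, y, z) \<Rightarrow> Delta z f x * K (x, y, z) * q x * q y))"
    by (intro Bochner_Integration.integral_cong) (auto simp: algebra_simps)
  also have "\<dots> = form f p p - form f q q"
    unfolding form_def by (intro Bochner_Integration.integral_diff I p q)
  finally show ?thesis by simp
qed

text \<open>The sign of \<open>e'\<close> instead of that of \<open>e\<close> costs the second term, which disappears as \<open>e\<close>
  approaches \<open>e'\<close>. The second difference of \<open>min w n\<close> is at most that of \<open>w\<close> at points with
  \<open>w x \<le> n\<close>, and nonpositive at all others.\<close>

lemma form_truncated_weight_first:
  assumes \<sigma>: "\<sigma> \<in> borel_measurable borel" "\<And>x. \<bar>\<sigma> x\<bar> \<le> 1" "\<And>x. \<sigma> x * e' x = \<bar>e' x\<bar>"
    and e: "admissible e" and e': "admissible e'" and c: "admissible c" "\<And>x. 0 \<le> c x" and n: "0 \<le> n"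
  shows "form (\<lambda>x. min (w x) n * \<sigma> x) e c
    \<le> integral\<^sup>L lborel \<Phi> * wnorm c * (wnorm e + 4 * n * wnorm (\<lambda>x. e x - e' x))"
proof -
  define W where "W x = min (w x) n" for x
  define f where "f x = W x * \<sigma> x" for x
  note [measurable] = \<sigma>(1)
  have W0: "0 \<le> W x" for x using n w_nonneg by (simp add: W_def)
  have fm: "f \<in> borel_measurable borel" unfolding f_def W_def by measurable
  have fW: "\<bar>f x\<bar> \<le> W x" for x
    using W0[of x] \<sigma>(2)[of x] by (simp add: f_def abs_mult mult_left_le)
  have fn: "\<bar>f x\<bar> \<le> n" for x using fW[of x] by (simp add: W_def)
  have "admissible (\<lambda>x. e x - e' x)" using e e' by (rule admissible_diff)
  note P1 = integrable_lborel_mult_triple[OF admissible_integrable(2)[OF e] admissible_integrable(2)[OF c(1)] \<Phi>_integrable]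
  note P2 = integrable_lborel_mult_triple[OF integrable_mult_right[OF admissible_integrable(2)[OF \<open>admissible (\<lambda>x. e x - e' x)\<close>]]
      admissible_integrable(2)[OF c(1)] \<Phi>_integrable, of "4 * n"]
  have le: "AE v in lborel. (case v of (x, y, z) \<Rightarrow> Delta z f x * K (x, y, z) * e x * c y)
    \<le> (case v of (x, y, z) \<Rightarrow> (w x * \<bar>e x\<bar>) * (w y * \<bar>c y\<bar>) * \<Phi> z)
      + (case v of (x, y, z) \<Rightarrow> (4 * n * (w x * \<bar>e x - e' x\<bar>)) * (w y * \<bar>c y\<bar>) * \<Phi> z)"
    using K_le Delta_w_K_le
  proof eventually_elim
    case (elim v)
    obtain x y z where v: "v = (x, y, z)" by (cases v)
    define k R where "k = K (x, y, z)" and "R = w x * w y * \<Phi> z"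
    have k: "0 \<le> k" "k \<le> R" "Delta z w x * k \<le> R"
      using elim K_nonneg[of v] by (auto simp: v k_def R_def)
    have WR: "Delta z W x * k \<le> R"
    proof (cases "w x \<le> n")
      case True
      then have "Delta z W x \<le> Delta z w x" by (simp add: W_def Delta_def)
      from mult_right_mono[OF this k(1)] k(3) show ?thesis by linarith
    next
      case False
      then have "Delta z W x \<le> 0" by (simp add: W_def Delta_def)
      from mult_right_mono[OF this k(1)] k(1,2) show ?thesis by simp
    qed
    have pm: "f u * e x \<le> W u * \<bar>e x\<bar>" for u
      by (rule order_trans[OF abs_ge_self]) (auto simp: abs_mult intro!: mult_right_mono fW)
    \<comment> \<open>\<open>\<sigma>\<close> is adapted to \<open>e'\<close>. Passing to
      \<open>e\<close> costs \<open>\<bar>e x - e' x\<bar>\<close> twice: once in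
      \<open>\<sigma> x * (e x - e' x)\<close> and once in comparing \<open>\<bar>e' x\<bar>\<close>
      with \<open>\<bar>e x\<bar>\<close>.\<close>
    have "\<bar>e x\<bar> - 2 * \<bar>e x - e' x\<bar> \<le> \<sigma> x * e x"
    proof -
      have "\<bar>\<sigma> x * (e x - e' x)\<bar> \<le> 1 * \<bar>e x - e' x\<bar>"
        unfolding abs_mult by (intro mult_right_mono \<sigma>) auto
      then have "- \<bar>e x - e' x\<bar> \<le> \<sigma> x * e x - \<bar>e' x\<bar>"
        unfolding right_diff_distrib \<sigma>(3) by (simp add: abs_le_iff)
      then show ?thesis using abs_triangle_ineq2[of "e x" "e' x"] by (smt (verit))
    qed
    from mult_left_mono[OF this W0[of x]]
    have "W x * \<bar>e x\<bar> - 2 * (W x * \<bar>e x - e' x\<bar>) \<le> f x * e x"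
      by (simp add: f_def algebra_simps)
    moreover have "W x * \<bar>e x - e' x\<bar> \<le> n * \<bar>e x - e' x\<bar>"
      by (intro mult_right_mono) (auto simp: W_def)
    \<comment> \<open>At \<open>x + z\<close> and \<open>x - z\<close> the upper bound
      \<open>pm\<close> suffices. Only the middle value, which enters with coefficient -2, needs a
      lower bound; its loss of \<open>2 * n * \<bar>e x - e' x\<bar>\<close> is thereby doubled to
      the factor \<open>4 * n\<close>.\<close>
    ultimately have "Delta z f x * e x \<le> Delta z W x * \<bar>e x\<bar> + 4 * n * \<bar>e x - e' x\<bar>"
      using pm[of "x + z"] pm[of "x - z"] unfolding Delta_def by (simp add: algebra_simps)
    from mult_right_mono[OF this, of "k * c y"] k(1) c(2)[of y]
    have "Delta z f x * k * e x * c y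
      \<le> (Delta z W x * k) * (\<bar>e x\<bar> * c y) + k * (4 * n * \<bar>e x - e' x\<bar> * c y)"
      by (simp add: algebra_simps)
    also have "\<dots> \<le> R * (\<bar>e x\<bar> * c y) + R * (4 * n * \<bar>e x - e' x\<bar> * c y)"
      using WR k n c(2)[of y] by (intro add_mono mult_right_mono) auto
    finally show ?case using c(2)[of y] by (simp add: v k_def R_def algebra_simps)
  qed
  have "form f e c \<le> (LINT v|lborel. (case v of (x, y, z) \<Rightarrow> (w x * \<bar>e x\<bar>) * (w y * \<bar>c y\<bar>) * \<Phi> z)
      + (case v of (x, y, z) \<Rightarrow> (4 * n * (w x * \<bar>e x - e' x\<bar>)) * (w y * \<bar>c y\<bar>) * \<Phi> z))"
    unfolding form_def
    by (intro integral_mono_AE form_integrable(1)[OF fm fn e c(1)] Bochner_Integration.integrable_add P1(1) P2(1) le)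
  also have "\<dots> = integral\<^sup>L lborel \<Phi> * wnorm c * (wnorm e + 4 * n * wnorm (\<lambda>x. e x - e' x))"
    by (subst Bochner_Integration.integral_add[OF P1(1) P2(1)],
        unfold P1(2) P2(2) wnorm_def integral_mult_right_zero) (simp add: algebra_simps)
  finally show ?thesis by (simp add: f_def[abs_def] W_def)
qed

text \<open>With the difference \<open>e\<close> in the variable \<open>y\<close>, the test function
  at \<open>x\<close> carries no useful sign, so absolute values are taken throughout. The extra
  power of \<open>w x\<close> falls on \<open>d\<close>, whose \<open>w2norm\<close> is bounded. The
  bound \<open>M\<close> provides integrability and does not enter the estimate.\<close>

lemma form_truncated_weight_second:
  assumes f: "f \<in> borel_measurable borel" and M: "\<And>x. \<bar>f x\<bar> \<le> M" and fw: "\<And>x. \<bar>f x\<bar> \<le> w x"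
    and d: "admissible d" and e: "admissible e"
  shows "form f d e \<le> integral\<^sup>L lborel \<Phi> * w2norm d * wnorm e"
proof -
  note P = integrable_lborel_mult_triple[OF admissible_integrable(1)[OF d] admissible_integrable(2)[OF e] \<Phi>_integrable]
  have le: "AE v in lborel. (case v of (x, y, z) \<Rightarrow> Delta z f x * K (x, y, z) * d x * e y)
    \<le> (case v of (x, y, z) \<Rightarrow> ((w x)\<^sup>2 * \<bar>d x\<bar>) * (w y * \<bar>e y\<bar>) * \<Phi> z)"
    using sum_w_K_le
  proof eventually_elim
    case (elim v)
    obtain x y z where v: "v = (x, y, z)" by (cases v)
    have "\<bar>Delta z f x\<bar> \<le> w (x + z) + 2 * w x + w (x - z)"
      using fw[of "x + z"] fw[of x] fw[of "x - z"] unfolding Delta_def by linarith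
    from mult_right_mono[OF this K_nonneg[of v]] elim
    have "\<bar>Delta z f x\<bar> * K v \<le> (w x)\<^sup>2 * w y * \<Phi> z" by (simp add: v)
    from mult_right_mono[OF this, of "\<bar>d x\<bar> * \<bar>e y\<bar>"]
    have "\<bar>Delta z f x * K v * d x * e y\<bar> \<le> (w x)\<^sup>2 * w y * \<Phi> z * (\<bar>d x\<bar> * \<bar>e y\<bar>)"
      using K_nonneg[of v] by (simp add: abs_mult mult_ac)
    then show ?case by (simp add: v mult_ac)
  qed
  have "form f d e \<le> (LINT (x, y, z)|lborel. ((w x)\<^sup>2 * \<bar>d x\<bar>) * (w y * \<bar>e y\<bar>) * \<Phi> z)"
    unfolding form_def by (intro integral_mono_AE form_integrable(1)[OF f M d e] P(1) le)
  also have "\<dots> = integral\<^sup>L lborel \<Phi> * w2norm d * wnorm e"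
    unfolding P(2) by (simp add: wnorm_def w2norm_def)
  finally show ?thesis .
qed

section \<open>Paths of densities: continuity in the weighted norm and of the collision term\<close>

definition density_path :: "real \<Rightarrow> real \<Rightarrow> (real \<Rightarrow> real \<Rightarrow> real) \<Rightarrow> bool" where
  "density_path B \<tau> c \<longleftrightarrow>
    (\<forall>t\<in>{0..\<tau>}. admissible (c t) \<and> (\<forall>x. 0 \<le> c t x) \<and> w2norm (c t) \<le> B) \<and>
    (\<forall>t\<in>{0..\<tau>}. ((\<lambda>s. LINT x|lborel. \<bar>c s x - c t x\<bar>) \<longlongrightarrow> 0) (at t within {0..\<tau>}))"

lemma density_pathD:
  assumes "density_path B \<tau> c" "t \<in> {0..\<tau>}"
  shows "admissible (c t)" "0 \<le> c t x" "w2norm (c t) \<le> B" "wnorm (c t) \<le> B" "0 \<le> B"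
    "((\<lambda>s. LINT x|lborel. \<bar>c s x - c t x\<bar>) \<longlongrightarrow> 0) (at t within {0..\<tau>})"
proof -
  show *: "admissible (c t)" "w2norm (c t) \<le> B" using assms unfolding density_path_def by auto
  show "wnorm (c t) \<le> B" using wnorm_le_w2norm[OF *(1)] *(2) by simp
  show "0 \<le> B" using w2norm_nonneg[of "c t"] *(2) by simp
qed (use assms in \<open>auto simp: density_path_def\<close>)

lemma density_path_wnorm_tendsto:
  assumes c: "density_path B \<tau> c" and t: "t \<in> {0..\<tau>}"
  shows "((\<lambda>s. wnorm (\<lambda>x. c s x - c t x)) \<longlongrightarrow> 0) (at t within {0..\<tau>})"
proof (rule tendstoI)
  fix \<epsilon> :: real assume \<epsilon>: "0 < \<epsilon>"
  \<comment> \<open>The difference has \<open>w2norm\<close> at most \<open>2 * B\<close>, so this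
    \<open>M\<close> keeps the moment part of the interpolation below \<open>\<epsilon> / 2\<close>;
    the summand 1 keeps \<open>M\<close> positive when \<open>B = 0\<close>. The L^1 part is then
    made smaller than \<open>\<epsilon> / 2\<close> for this fixed \<open>M\<close>.\<close>
  define M where "M = (4 * B + 1) / \<epsilon>"
  have B: "0 \<le> B" using density_pathD(5)[OF c t] .
  then have M: "0 < M" using \<epsilon> by (simp add: M_def)
  have "\<forall>\<^sub>F s in at t within {0..\<tau>}. (LINT x|lborel. \<bar>c s x - c t x\<bar>) < \<epsilon> / (2 * M)"
    using order_tendstoD(2)[OF density_pathD(6)[OF c t]] \<epsilon> M by simp
  moreover have "\<forall>\<^sub>F s in at t within {0..\<tau>}. s \<in> {0..\<tau>}"
    by (simp add: eventually_at_filter)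
  ultimately show "\<forall>\<^sub>F s in at t within {0..\<tau>}. dist (wnorm (\<lambda>x. c s x - c t x)) 0 < \<epsilon>"
  proof eventually_elim
    case (elim s)
    note a = density_pathD(1)[OF c elim(2)] density_pathD(1)[OF c t]
    have "w2norm (\<lambda>x. c s x - c t x) \<le> 2 * B"
      using w2norm_diff_le[OF a] density_pathD(3)[OF c elim(2)] density_pathD(3)[OF c t] by simp
    then have "w2norm (\<lambda>x. c s x - c t x) / M \<le> 2 * B / M" using M by (simp add: divide_right_mono)
    also have "\<dots> \<le> \<epsilon> / 2" using \<epsilon> B by (simp add: M_def field_simps)
    finally have "w2norm (\<lambda>x. c s x - c t x) / M \<le> \<epsilon> / 2" .
    moreover have "M * (LINT x|lborel. \<bar>c s x - c t x\<bar>) < M * (\<epsilon> / (2 * M))"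
      using elim(1) M by (intro mult_strict_left_mono)
    moreover have "M * (\<epsilon> / (2 * M)) = \<epsilon> / 2" using M by simp
    ultimately have "wnorm (\<lambda>x. c s x - c t x) < \<epsilon>"
      using wnorm_interpolation[OF admissible_diff[OF a] M] by linarith
    then show ?case by (simp add: wnorm_nonneg)
  qed
qed

text \<open>By \<open>form_diff\<close> the increment consists of two forms with the difference
  \<open>c s - c t\<close> in one argument, and \<open>form_integrable\<close> bounds each by a
  multiple of its \<open>wnorm\<close>. Continuity makes the time integrals below meaningful as
  gauge integrals.\<close>

lemma density_path_form_continuous:
  assumes f: "f \<in> borel_measurable borel" and M: "\<And>x. \<bar>f x\<bar> \<le> M" and c: "density_path B \<tau> c"
  shows "continuous_on {0..\<tau>} (\<lambda>r. form f (c r) (c r))"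
  unfolding continuous_on_def
proof
  fix t assume t: "t \<in> {0..\<tau>}"
  define A where "A = 4 * M * integral\<^sup>L lborel \<Phi>"
  have A: "0 \<le> A" unfolding A_def using M[of 0]
    by (intro mult_nonneg_nonneg Bochner_Integration.integral_nonneg \<Phi>_nonneg) auto
  have ev: "\<forall>\<^sub>F s in at t within {0..\<tau>}. s \<in> {0..\<tau>}"
    by (simp add: eventually_at_filter)
  have "((\<lambda>s. form f (c s) (c s) - form f (c t) (c t)) \<longlongrightarrow> 0) (at t within {0..\<tau>})"
  proof (rule Lim_null_comparison)
    show "((\<lambda>s. 2 * A * B * wnorm (\<lambda>x. c s x - c t x)) \<longlongrightarrow> 0) (at t within {0..\<tau>})"
      by (rule tendsto_mult_right_zero[OF density_path_wnorm_tendsto[OF c t]])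
    show "\<forall>\<^sub>F s in at t within {0..\<tau>}. norm (form f (c s) (c s) - form f (c t) (c t))
        \<le> 2 * A * B * wnorm (\<lambda>x. c s x - c t x)"
      using ev
    proof eventually_elim
      case (elim s)
      note a = density_pathD(1)[OF c elim] density_pathD(1)[OF c t]
      define n where "n = wnorm (\<lambda>x. c s x - c t x)"
      have "\<bar>form f (\<lambda>x. c s x - c t x) (c s)\<bar> \<le> A * n * wnorm (c s)"
        unfolding A_def n_def by (intro form_integrable(2)[OF f M] admissible_diff a)
      also have "\<dots> \<le> A * n * B"
        using A by (intro mult_left_mono density_pathD[OF c elim] mult_nonneg_nonneg) (auto simp: n_def wnorm_nonneg)
      finally have 1: "\<bar>form f (\<lambda>x. c s x - c t x) (c s)\<bar> \<le> A * n * B" .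
      have "\<bar>form f (c t) (\<lambda>x. c s x - c t x)\<bar> \<le> A * wnorm (c t) * n"
        unfolding A_def n_def by (intro form_integrable(2)[OF f M] admissible_diff a)
      also have "\<dots> \<le> A * B * n"
        using A by (intro mult_left_mono mult_right_mono density_pathD[OF c t]) (auto simp: n_def wnorm_nonneg)
      finally have 2: "\<bar>form f (c t) (\<lambda>x. c s x - c t x)\<bar> \<le> A * B * n" .
      show ?case
        using 1 2 unfolding form_diff[OF f M a] n_def[symmetric] by (simp add: algebra_simps)
    qed
  qed
  then show "((\<lambda>r. form f (c r) (c r)) \<longlongrightarrow> form f (c t) (c t)) (at t within {0..\<tau>})"
    by (simp add: LIM_zero_iff)
qed

section \<open>The Gronwall argument for the difference of two solutions\<close>

lemma admissible_zero_if_wnorm_zero: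
  assumes e: "admissible e" and 0: "wnorm e = 0"
  shows "AE x in lborel. e x = 0"
proof -
  have "AE x in lborel. w x * \<bar>e x\<bar> = 0"
    using 0 integral_nonneg_eq_0_iff_AE[OF admissible_integrable(2)[OF e]] w_nonneg by (simp add: wnorm_def)
  then show ?thesis
  proof eventually_elim
    case (elim x)
    then show ?case using admissible_le_w(1)[OF e, of x] by linarith
  qed
qed

text \<open>Three limits are taken in a fixed order: the time steps with frozen sign are localized,
  their error parameter \<open>\<epsilon>\<close> tends to 0 for fixed truncation level
  \<open>n\<close>, and finally \<open>n\<close> tends to infinity. The constant \<open>L\<close>
  survives because it depends on neither \<open>\<epsilon>\<close> nor \<open>n\<close>.\<close>

lemma uniqueness:
  assumes c: "density_path B \<tau> c" and d: "density_path B \<tau> d"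
    and weak: "\<And>f M t. f \<in> borel_measurable borel \<Longrightarrow> (\<And>x. \<bar>f x\<bar> \<le> M) \<Longrightarrow> t \<in> {0..\<tau>} \<Longrightarrow>
      (LINT x|lborel. f x * (c t x - d t x))
        = integral {0..t} (\<lambda>r. form f (c r) (c r) - form f (d r) (d r))"
    and t: "t \<in> {0..\<tau>}"
  shows "AE x in lborel. c t x = d t x"
proof -
  define e where "e s = (\<lambda>x. c s x - d s x)" for s
  define N where "N s = wnorm (e s)" for s
  define P where "P = integral\<^sup>L lborel \<Phi>"
  \<comment> \<open>One \<open>P * B\<close> comes from each of the two forms in
    \<open>form_diff\<close>.\<close>
  define L where "L = 2 * P * B"
  have B: "0 \<le> B" using density_pathD(5)[OF c t] .
  have P: "0 \<le> P" unfolding P_def by (intro Bochner_Integration.integral_nonneg \<Phi>_nonneg)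
  have L: "0 \<le> L" using B P by (simp add: L_def)
  have e: "admissible (e s)" if "s \<in> {0..\<tau>}" for s
    unfolding e_def using density_pathD(1)[OF c that] density_pathD(1)[OF d that] by (rule admissible_diff)
  have N0: "0 \<le> N s" for s by (simp add: N_def wnorm_nonneg)
  have lim_e: "((\<lambda>s. wnorm (\<lambda>x. e s x - e u x)) \<longlongrightarrow> 0) (at u within {0..\<tau>})" if u: "u \<in> {0..\<tau>}" for u
  proof (rule Lim_null_comparison)
    show "((\<lambda>s. wnorm (\<lambda>x. c s x - c u x) + wnorm (\<lambda>x. d s x - d u x)) \<longlongrightarrow> 0) (at u within {0..\<tau>})"
      using tendsto_add[OF density_path_wnorm_tendsto[OF c u] density_path_wnorm_tendsto[OF d u]] by simp
    have "\<forall>\<^sub>F s in at u within {0..\<tau>}. s \<in> {0..\<tau>}" by (simp add: eventually_at_filter)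
    then show "\<forall>\<^sub>F s in at u within {0..\<tau>}. norm (wnorm (\<lambda>x. e s x - e u x))
        \<le> wnorm (\<lambda>x. c s x - c u x) + wnorm (\<lambda>x. d s x - d u x)"
    proof eventually_elim
      case (elim s)
      have c': "admissible (\<lambda>x. c s x - c u x)" by (intro admissible_diff density_pathD(1)[OF c] elim u)
      have d': "admissible (\<lambda>x. d s x - d u x)" by (intro admissible_diff density_pathD(1)[OF d] elim u)
      have z: "admissible (\<lambda>x. 0)" by (simp add: admissible_def)
      have "wnorm (\<lambda>x. e s x - e u x) = wnorm (\<lambda>x. (c s x - c u x) - (d s x - d u x))"
        by (simp add: e_def algebra_simps)
      also have "\<dots> \<le> wnorm (\<lambda>x. c s x - c u x) + wnorm (\<lambda>x. d s x - d u x)"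
        using wnorm_triangle[OF c' z d'] unfolding wnorm_def diff_0 abs_minus_cancel by simp
      finally show ?case by (simp add: wnorm_nonneg)
    qed
  qed
  have N_cont: "continuous_on {0..\<tau>} N"
    unfolding continuous_on_def
  proof
    fix u assume u: "u \<in> {0..\<tau>}"
    have "((\<lambda>s. N s - N u) \<longlongrightarrow> 0) (at u within {0..\<tau>})"
    proof (rule Lim_null_comparison[OF _ lim_e[OF u]])
      have "\<forall>\<^sub>F s in at u within {0..\<tau>}. s \<in> {0..\<tau>}" by (simp add: eventually_at_filter)
      then show "\<forall>\<^sub>F s in at u within {0..\<tau>}. norm (N s - N u) \<le> wnorm (\<lambda>x. e s x - e u x)"
        by eventually_elim (use abs_wnorm_diff_le e u in \<open>auto simp: N_def\<close>)
    qed
    then show "(N \<longlongrightarrow> N u) (at u within {0..\<tau>})" by (simp add: LIM_zero_iff)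
  qed
  have N_int: "N integrable_on {a..b}" if "0 \<le> a" "b \<le> \<tau>" for a b
    using that by (intro integrable_continuous_real continuous_on_subset[OF N_cont]) auto
  have trunc: "(LINT x|lborel. min (w x) n * \<bar>e u x\<bar>) \<le> L * integral {0..u} N"
    if u: "u \<in> {0..\<tau>}" and n: "0 \<le> n" for n u
  proof -
    define W where "W x = min (w x) n" for x
    define G where "G s = (LINT x|lborel. W x * \<bar>e s x\<bar>)" for s
    \<comment> \<open>The sign is frozen at time \<open>s\<close>, so \<open>f s\<close> is one
      bounded test function for all times \<open>r\<close>.\<close>
    define f where "f s = (\<lambda>x. W x * sgn (e s x))" for s
    define g where "g s r = form (f s) (c r) (c r) - form (f s) (d r) (d r)" for s r
    have W: "0 \<le> W x" "W x \<le> w x" "W x \<le> n" for x using n w_nonneg by (auto simp: W_def)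
    have Wm [measurable]: "W \<in> borel_measurable borel" unfolding W_def by measurable
    have fm: "f s \<in> borel_measurable borel" if "s \<in> {0..\<tau>}" for s
      using admissible_measurable[OF e[OF that]] unfolding f_def by measurable
    have fW: "\<bar>f s x\<bar> \<le> W x" for s x
      using W(1)[of x] by (simp add: f_def abs_mult abs_sgn_eq)
    have fn: "\<bar>f s x\<bar> \<le> n" and fw: "\<bar>f s x\<bar> \<le> w x" for s x
      using fW[of s x] W[of x] by linarith+
    have g_cont: "continuous_on {0..\<tau>} (g s)" if "s \<in> {0..\<tau>}" for s
      unfolding g_def by (intro continuous_on_diff density_path_form_continuous[OF fm[OF that] fn c]
          density_path_form_continuous[OF fm[OF that] fn d])
    have g_int: "g s integrable_on {a..b}" if "0 \<le> a" "b \<le> \<tau>" "s \<in> {0..\<tau>}" for a b s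
      using that by (intro integrable_continuous_real continuous_on_subset[OF g_cont]) auto
    have g_le: "g s r \<le> L * N r + 4 * n * P * B * wnorm (\<lambda>x. e r x - e s x)"
      if r: "r \<in> {0..\<tau>}" and s: "s \<in> {0..\<tau>}" for r s
    proof -
      define m where "m = N r + 4 * n * wnorm (\<lambda>x. e r x - e s x)"
      have m: "0 \<le> m" using N0 n by (simp add: m_def wnorm_nonneg)
      have "g s r = form (f s) (e r) (c r) + form (f s) (d r) (e r)"
        unfolding g_def e_def by (rule form_diff[OF fm[OF s] fn density_pathD(1)[OF c r] density_pathD(1)[OF d r]])
      moreover have "form (f s) (e r) (c r) \<le> P * wnorm (c r) * m"
        unfolding f_def W_def P_def m_def N_def
        by (rule form_truncated_weight_first)
          (use e[OF r] e[OF s] admissible_measurable[OF e[OF s]] density_pathD(1,2)[OF c r] n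
            in \<open>auto simp: abs_sgn_eq mult_sgn_abs sgn_mult_self_eq abs_sgn mult.commute\<close>)
      moreover have "P * wnorm (c r) * m \<le> P * B * m"
        using density_pathD(4)[OF c r] P m by (intro mult_right_mono mult_left_mono)
      moreover have "form (f s) (d r) (e r) \<le> P * w2norm (d r) * N r"
        unfolding P_def N_def
        by (rule form_truncated_weight_second[OF fm[OF s] fn fw density_pathD(1)[OF d r] e[OF r]])
      moreover have "P * w2norm (d r) * N r \<le> P * B * N r"
        using density_pathD(3)[OF d r] P N0 by (intro mult_right_mono mult_left_mono)
      ultimately have "g s r \<le> P * B * m + P * B * N r" by linarith
      then show ?thesis by (simp add: L_def m_def algebra_simps)
    qed
    have weak': "(LINT x|lborel. f s x * e r x) = integral {0..r} (g s)"
      if "r \<in> {0..\<tau>}" "s \<in> {0..\<tau>}" for r s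
      unfolding g_def e_def by (rule weak[OF fm[OF that(2)] fn that(1)])
    \<comment> \<open>Testing with \<open>f s\<close> gives exactly \<open>G s\<close> at time
      \<open>s\<close> and, by \<open>G_le\<close>, at most \<open>G r\<close> at any other time.
      Freezing at the right endpoint of a step therefore bounds the increase of \<open>G\<close>
      from above.\<close>
    have G_self: "(LINT x|lborel. f s x * e s x) = G s" for s
      unfolding G_def f_def by (simp add: abs_sgn mult_ac)
    have f_int: "integrable lborel (\<lambda>x. f s x * e r x)" "integrable lborel (\<lambda>x. W x * \<bar>e r x\<bar>)"
      if r: "r \<in> {0..\<tau>}" and s: "s \<in> {0..\<tau>}" for r s
    proof -
      note [measurable] = fm[OF s] admissible_measurable[OF e[OF r]]
      show "integrable lborel (\<lambda>x. f s x * e r x)"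
        by (rule Bochner_Integration.integrable_bound[OF admissible_integrable(2)[OF e[OF r]]])
          (auto simp: abs_mult w_nonneg intro!: mult_right_mono fw)
      show "integrable lborel (\<lambda>x. W x * \<bar>e r x\<bar>)"
        by (rule Bochner_Integration.integrable_bound[OF admissible_integrable(2)[OF e[OF r]]])
          (auto simp: abs_mult w_nonneg W intro!: mult_right_mono)
    qed
    have G_le: "(LINT x|lborel. f s x * e r x) \<le> G r" if "r \<in> {0..\<tau>}" "s \<in> {0..\<tau>}" for r s
      unfolding G_def
    proof (rule integral_mono[OF f_int[OF that]])
      show "f s x * e r x \<le> W x * \<bar>e r x\<bar>" for x
        by (rule order_trans[OF abs_ge_self]) (auto simp: abs_mult intro!: mult_right_mono fW)
    qed
    have G0: "G 0 = 0"
      using weak'[of 0 0] G_self[of 0] u by simp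
    \<comment> \<open>Twice the factor in \<open>g_le\<close>, since two times near \<open>x\<close>
      are compared through \<open>x\<close> and differ by at most \<open>2 * \<epsilon>\<close> in
      \<open>wnorm\<close>. The dependence on \<open>n\<close> is harmless because \<open>C\<close>
      only multiplies \<open>\<epsilon>\<close>.\<close>
    define C where "C = 8 * n * P * B"
    have C: "0 \<le> C" using n P B by (simp add: C_def)
    have step: "G u \<le> L * integral {0..u} N + C * \<epsilon> * u" if \<epsilon>: "0 < \<epsilon>" for \<epsilon>
    proof -
      have "0 \<le> u" using u by simp
      \<comment> \<open>The estimate for an increment is additive over adjacent intervals and holds
        on all short intervals around each point, so bisection extends it to \<open>{0..u}\<close>
        without a uniform step size. The guard covers short intervals that leave
        \<open>{0..\<tau>}\<close>.\<close>
      define Q where "Q a b \<longleftrightarrow> (0 \<le> a \<and> a \<le> b \<and> b \<le> \<tau> \<longrightarrow>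
        G b - G a \<le> L * integral {a..b} N + C * \<epsilon> * (b - a))" for a b
      have "Q 0 u"
        using \<open>0 \<le> u\<close>
      proof (rule Bolzano[where P = Q])
        fix a b c assume trans: "Q a b" "Q b c" "a \<le> b" "b \<le> c"
        show "Q a c"
          unfolding Q_def
        proof
          assume *: "0 \<le> a \<and> a \<le> c \<and> c \<le> \<tau>"
          have "integral {a..b} N + integral {b..c} N = integral {a..c} N"
            using * trans by (intro Henstock_Kurzweil_Integration.integral_combine N_int) auto
          from arg_cong[OF this, of "\<lambda>x. L * x"] show "G c - G a \<le> L * integral {a..c} N + C * \<epsilon> * (c - a)"
            using trans * by (auto simp: Q_def algebra_simps)
        qed
      next
        fix x assume "0 \<le> x" "x \<le> u"
        then have x: "x \<in> {0..\<tau>}" using u by auto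
        have "\<forall>\<^sub>F r in at x within {0..\<tau>}. wnorm (\<lambda>y. e r y - e x y) < \<epsilon>"
          using order_tendstoD(2)[OF lim_e[OF x] \<epsilon>] .
        then obtain \<delta> where \<delta>: "0 < \<delta>"
          and \<delta>': "\<And>r. r \<in> {0..\<tau>} \<Longrightarrow> r \<noteq> x \<Longrightarrow> dist r x < \<delta> \<Longrightarrow> wnorm (\<lambda>y. e r y - e x y) < \<epsilon>"
          unfolding eventually_at by blast
        have near: "wnorm (\<lambda>y. e r y - e x y) \<le> \<epsilon>" if "r \<in> {0..\<tau>}" "\<bar>r - x\<bar> < \<delta>" for r
          using \<delta>'[of r] that \<epsilon> by (cases "r = x") (auto simp: dist_real_def wnorm_def)
        show "\<exists>\<delta>>0. \<forall>a b. a \<le> x \<and> x \<le> b \<and> b - a < \<delta> \<longrightarrow> Q a b"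
          unfolding Q_def
        proof (intro exI[of _ \<delta>] conjI allI impI \<delta>)
          fix a b assume ab: "a \<le> x \<and> x \<le> b \<and> b - a < \<delta>" and ab': "0 \<le> a \<and> a \<le> b \<and> b \<le> \<tau>"
          have mem: "a \<in> {0..\<tau>}" "b \<in> {0..\<tau>}" using ab' by auto
          have bound: "g b r \<le> L * N r + C * \<epsilon>" if r: "r \<in> {a..b}" for r
          proof -
            have r': "r \<in> {0..\<tau>}" using r ab' by auto
            have "wnorm (\<lambda>y. e r y - e b y) \<le> wnorm (\<lambda>y. e r y - e x y) + wnorm (\<lambda>y. e x y - e b y)"
              by (intro wnorm_triangle e r' x mem)
            also have "\<dots> \<le> 2 * \<epsilon>"
            proof -
              have "\<bar>r - x\<bar> < \<delta>" "\<bar>b - x\<bar> < \<delta>" using r ab by auto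
              then show ?thesis
                using near[OF r'] near[OF mem(2)] wnorm_diff_commute[of "e x" "e b"] by simp
            qed
            finally have "4 * n * P * B * wnorm (\<lambda>y. e r y - e b y) \<le> 4 * n * P * B * (2 * \<epsilon>)"
              using n P B by (intro mult_left_mono) auto
            moreover have "4 * n * P * B * (2 * \<epsilon>) = C * \<epsilon>" by (simp add: C_def)
            ultimately show ?thesis using g_le[OF r' mem(2)] by linarith
          qed
          \<comment> \<open>The sign at \<open>b\<close> is exact at \<open>b\<close> and
            underestimates \<open>G a\<close>; the weak formulation then expresses the increment as
            an integral over \<open>{a..b}\<close>.\<close>
          have "G b - G a \<le> (LINT x|lborel. f b x * e b x) - (LINT x|lborel. f b x * e a x)"
            using G_self[of b] G_le[OF mem] by simp
          also have "\<dots> = integral {a..b} (g b)"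
            using Henstock_Kurzweil_Integration.integral_combine[of 0 a b "g b"] g_int[of 0 b b] ab' mem
            by (simp add: weak')
          also have "\<dots> \<le> integral {a..b} (\<lambda>r. L * N r + C * \<epsilon>)"
            using ab' mem bound
            by (intro integral_le g_int integrable_add integrable_on_mult_right N_int integrable_const_ivl) auto
          also have "\<dots> = L * integral {a..b} N + C * \<epsilon> * (b - a)"
            using ab' by (subst Henstock_Kurzweil_Integration.integral_add)
              (auto intro!: integrable_on_mult_right N_int)
          finally show "G b - G a \<le> L * integral {a..b} N + C * \<epsilon> * (b - a)" .
        qed
      qed
      then show ?thesis using G0 u by (simp add: Q_def)
    qed
    have "G u \<le> L * integral {0..u} N"
    proof (rule field_le_epsilon)
      fix \<epsilon> :: real assume \<epsilon>: "0 < \<epsilon>"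
      \<comment> \<open>Chosen so that the accumulated error \<open>C * \<eta> * u\<close> is at
        most \<open>\<epsilon>\<close>; the summand 1 covers \<open>C * u = 0\<close>.\<close>
      define \<eta> where "\<eta> = \<epsilon> / (C * u + 1)"
      have Cu: "0 \<le> C * u" using C u by simp
      then have \<eta>: "0 < \<eta>" using \<epsilon> by (simp add: \<eta>_def)
      have "C * \<eta> * u \<le> \<epsilon>" using Cu \<epsilon> by (simp add: \<eta>_def field_simps)
      then show "G u \<le> L * integral {0..u} N + \<epsilon>" using step[OF \<eta>] by simp
    qed
    then show ?thesis by (simp add: G_def W_def)
  qed
  have "N u \<le> L * integral {0..u} N" if u: "u \<in> {0..\<tau>}" for u
    unfolding N_def[of u] wnorm_def
    by (rule LIMSEQ_le_const2[OF integral_truncated_weight_tendsto[OF w_measurable w_nonneg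
        admissible_measurable[OF e[OF u]] admissible_integrable(2)[OF e[OF u]]]]) (simp add: trunc[OF u])
  then have "N t = 0"
    by (rule gronwall_zero[OF N_cont _ N0 L t])
  then have "AE x in lborel. e t x = 0"
    unfolding N_def by (rule admissible_zero_if_wnorm_zero[OF e[OF t]])
  then show ?thesis by (simp add: e_def)
qed

end

subsection \<open>The weight of the exchange kernel\<close>

text \<open>Subadditivity of a concave power: \<open>t \<le> t powr p\<close> on the unit interval,
  applied to the fractions \<open>a / (a + b)\<close> and \<open>b / (a + b)\<close>, which sum to
  1.\<close>

lemma powr_add_le:
  fixes a b p :: real
  assumes "0 \<le> a" "0 \<le> b" "0 \<le> p" "p \<le> 1"
  shows "(a + b) powr p \<le> a powr p + b powr p"
proof (cases "a + b = 0")
  case False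
  then have s: "0 < a + b" using assms by linarith
  have "t / (a + b) \<le> (t / (a + b)) powr p" if "0 \<le> t" "t \<le> a + b" for t
    using powr_mono'[of p 1 "t / (a + b)"] assms that s by (simp add: divide_le_eq_1)
  from this[of a] this[of b] have "a / (a + b) + b / (a + b) \<le> (a powr p + b powr p) / (a + b) powr p"
    using assms by (simp add: powr_divide add_divide_distrib)
  moreover have "a / (a + b) + b / (a + b) = 1" using s by (simp flip: add_divide_distrib)
  ultimately show ?thesis using s by (simp add: le_divide_eq)
qed simp

text \<open>Both first differences are derivatives at intermediate points \<open>r < s\<close> less
  than \<open>2 * z\<close> apart. The derivative has exponent \<open>l - 1\<close> between 0 and 1,
  so subadditivity bounds its increase by a power of \<open>z\<close> alone. This keeps the second
  difference of the weight from growing with \<open>x\<close>.\<close>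

lemma second_difference_powr_le:
  fixes x z l :: real
  assumes z: "0 < z" "z \<le> x" and l: "1 \<le> l" "l \<le> 2"
  shows "(x + z) powr l - 2 * x powr l + (x - z) powr l \<le> 4 * z powr l"
proof -
  have two: "2 powr l \<le> (4::real)"
    using powr_mono[of l 2 "2::real"] l by (simp add: powr_numeral)
  show ?thesis
  proof (cases "z = x")
    \<comment> \<open>Here the left interval would start at 0, outside the range of the derivative
      rule \<open>D\<close>; the three powers are computed directly.\<close>
    case True
    have "(x + z) powr l = 2 powr l * x powr l" "(x - z) powr l = 0" "z powr l = x powr l"
      using True z by (simp_all flip: powr_mult)
    then show ?thesis
      using mult_right_mono[OF two powr_ge_zero[of x l]] powr_ge_zero[of x l] by linarith
  next
    case False
    then have zx: "z < x" using z by simp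
    have D: "((\<lambda>t. t powr l) has_real_derivative l * t powr (l - 1)) (at t)" if "0 < t" for t :: real
      using that by (auto intro!: derivative_eq_intros)
    obtain s where s: "x < s" "s < x + z" "(x + z) powr l - x powr l = z * (l * s powr (l - 1))"
      using MVT2[of x "x + z" "\<lambda>t. t powr l" "\<lambda>t. l * t powr (l - 1)"] D zx z by (auto simp: algebra_simps)
    obtain r where r: "x - z < r" "r < x" "x powr l - (x - z) powr l = z * (l * r powr (l - 1))"
      using MVT2[of "x - z" x "\<lambda>t. t powr l" "\<lambda>t. l * t powr (l - 1)"] D zx z by (auto simp: algebra_simps)
    have "s powr (l - 1) \<le> (r + 2 * z) powr (l - 1)"
      using s r zx l by (intro powr_mono2) auto
    also have "\<dots> \<le> r powr (l - 1) + (2 * z) powr (l - 1)"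
      using r zx z l by (intro powr_add_le) auto
    finally have "s powr (l - 1) - r powr (l - 1) \<le> (2 * z) powr (l - 1)" by simp
    from mult_left_mono[OF this, of "z * l"]
    have "z * (l * s powr (l - 1)) - z * (l * r powr (l - 1)) \<le> l * (z * (2 * z) powr (l - 1))"
      using z l by (simp add: algebra_simps)
    also have "\<dots> = (l * 2 powr (l - 1)) * z powr l"
      using z by (simp add: powr_mult powr_diff field_simps)
    also have "\<dots> \<le> (2 * 2) * z powr l"
      using powr_mono[of "l - 1" 1 "2::real"] l by (intro mult_right_mono mult_mono) auto
    finally show ?thesis using s(3) r(3) by simp
  qed
qed

text \<open>A sum comparable to the product \<open>hat x powr (-\<alpha>) * check x powr l\<close>
  of the kernel bound for \<open>x > 0\<close>. In the second difference the first summand is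
  handled by monotonicity and the second by the bound for powers.\<close>

definition weight :: "real \<Rightarrow> real \<Rightarrow> real \<Rightarrow> real" where
  "weight \<alpha> l x = hat x powr (-\<alpha>) + x powr l"

lemma weight_measurable [measurable]: "weight \<alpha> l \<in> borel_measurable borel"
  unfolding weight_def hat_def by measurable

lemma weight_nonneg: "0 \<le> weight \<alpha> l x"
  by (simp add: weight_def)

lemma hat_powr_ge_1: "0 < x \<Longrightarrow> 0 \<le> \<alpha> \<Longrightarrow> 1 \<le> hat x powr (-\<alpha>)"
  using powr_mono'[of "-\<alpha>" 0 "hat x"] by (auto simp: hat_def split: if_splits)

lemma hat_powr_antimono: "0 < x \<Longrightarrow> x \<le> y \<Longrightarrow> 0 \<le> \<alpha> \<Longrightarrow> hat y powr (-\<alpha>) \<le> hat x powr (-\<alpha>)"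
  by (intro powr_mono2') (auto simp: hat_def)

lemma weight_ge_1: "0 < x \<Longrightarrow> 0 \<le> \<alpha> \<Longrightarrow> 1 \<le> weight \<alpha> l x"
  using hat_powr_ge_1[of x \<alpha>] by (simp add: weight_def add_increasing2)

lemma hat_check_powr_le_weight:
  assumes "0 < x" "0 \<le> \<alpha>"
  shows "hat x powr (-\<alpha>) * check x powr l \<le> weight \<alpha> l x"
  using assms by (cases "x \<le> 1") (auto simp: weight_def hat_def check_def)

lemma weight_le:
  assumes x: "0 < x" and l: "0 \<le> l"
  shows "weight \<alpha> l x \<le> 2 * (x powr (-\<alpha>) + x powr l)"
proof (cases "x \<le> 1")
  case False
  then have "weight \<alpha> l x = 1 + x powr l" by (simp add: weight_def hat_def)
  moreover have "1 \<le> x powr l" using False l by (simp add: ge_one_powr_ge_zero)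
  ultimately show ?thesis using powr_ge_zero[of x "-\<alpha>"] by argo
qed (use x in \<open>simp add: weight_def hat_def\<close>)

text \<open>Links the square moment in the uniqueness argument to the space with parameters
  \<open>2 * \<alpha>\<close> and \<open>2 * l\<close> in which the solutions live.\<close>

lemma weight_square_le:
  assumes x: "0 < x" and l: "0 \<le> l"
  shows "(weight \<alpha> l x)\<^sup>2 \<le> 4 * (x powr (- (2 * \<alpha>)) + x powr (2 * l))"
proof -
  have sq: "(t powr a)\<^sup>2 = t powr (2 * a)" if "0 < t" for t a :: real
    using that by (simp add: power2_eq_square flip: powr_add)
  have "0 < hat x" using x by (simp add: hat_def)
  have "(weight \<alpha> l x)\<^sup>2 \<le> 2 * (hat x powr (-\<alpha>))\<^sup>2 + 2 * (x powr l)\<^sup>2"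
    using sum_squares_bound[of "hat x powr (-\<alpha>)" "x powr l"] by (simp add: weight_def power2_sum)
  also have "\<dots> = 2 * hat x powr (-(2 * \<alpha>)) + 2 * x powr (2 * l)"
    using sq[OF x] sq[OF \<open>0 < hat x\<close>, of "-\<alpha>"] by simp
  also have "\<dots> = 2 * weight (2 * \<alpha>) (2 * l) x" by (simp add: weight_def)
  also have "\<dots> \<le> 4 * (x powr (-(2 * \<alpha>)) + x powr (2 * l))"
    using weight_le[OF x, of "2 * l" "2 * \<alpha>"] l by simp
  finally show ?thesis .
qed

text \<open>The bound on \<open>K\<close> near \<open>z = x\<close> involves \<open>hat x powr (- 2 * \<alpha>)\<close>, one factor \<open>hat x powr -\<alpha>\<close> too
  many for an estimate linear in the weight. Since \<open>z \<le> x\<close>, that factor is at most \<open>hat z powr -\<alpha>\<close>,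
  which the integrability of \<open>\<phi>\<close> absorbs.\<close>

lemma kernel_weight_bounds:
  fixes k C f :: real
  assumes x: "0 < x" and y: "0 < y" and z: "0 < z" "z \<le> x"
    and \<alpha>: "0 \<le> \<alpha>" and l: "1 \<le> l" "l \<le> 2" and k: "0 \<le> k" and f: "0 \<le> f" and C: "0 \<le> C"
    and bound: "k \<le> hat x powr (-\<alpha>) * hat y powr (-\<alpha>) * check x powr l * check y powr l * f"
    and singular: "hat (x - z) powr (-\<alpha>) * k
      \<le> C * hat x powr (-(2 * \<alpha>)) * hat y powr (-\<alpha>) * check x powr l * check y powr l * f"
  defines "w \<equiv> weight \<alpha> l"
  shows "k \<le> w x * w y * f"
    and "Delta z w x * k \<le> w x * w y * ((C + 7) * w z * f)"
    and "(w (x + z) + 2 * w x + w (x - z)) * k \<le> (w x)\<^sup>2 * w y * ((C + 7) * w z * f)"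
proof -
  define a where "a t = hat t powr (-\<alpha>)" for t
  define u where "u t = a t * check t powr l" for t
  have w: "w t = a t + t powr l" for t by (simp add: w_def weight_def a_def)
  have u: "u t \<le> w t" "0 \<le> u t" if "0 < t" for t
    using hat_check_powr_le_weight[OF that \<alpha>, of l] by (auto simp: u_def a_def w_def)
  have w1: "1 \<le> w t" if "0 < t" for t using weight_ge_1[OF that \<alpha>] by (simp add: w_def)
  have w0: "0 \<le> w t" for t by (simp add: w_def weight_nonneg)
  have a0: "0 \<le> a t" for t by (simp add: a_def)
  have aw: "a t \<le> w t" for t by (simp add: w)
  have a_mono: "a t \<le> a s" if "0 < s" "s \<le> t" for s t
    unfolding a_def by (rule hat_powr_antimono[OF that \<alpha>])
  have "k \<le> u x * u y * f" using bound by (simp add: u_def a_def mult_ac)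
  also have "\<dots> \<le> w x * w y * f" using u x y f w0 by (intro mult_right_mono mult_mono) auto
  finally show 1: "k \<le> w x * w y * f" .
  have "hat x powr (-(2 * \<alpha>)) = a x * a x" by (simp add: a_def flip: powr_add)
  then have "a (x - z) * k \<le> C * (a x * u x * u y * f)"
    using singular by (simp add: u_def a_def mult_ac)
  also have "\<dots> \<le> C * (a x * w x * w y * f)"
    using u x y f w0 a0 C by (intro mult_left_mono mult_right_mono mult_mono) auto
  finally have 2: "a (x - z) * k \<le> C * (a x * w x * w y * f)" .
  have p: "0 \<le> w x * w y * f" using w0 f by simp
  have "a x \<le> w z" using a_mono[OF z] aw[of z] by simp
  from mult_right_mono[OF this p]
  have 3: "a (x - z) * k \<le> C * (w z * (w x * w y * f))"
    using 2 C by (intro order_trans[OF 2] mult_left_mono) (auto simp: mult_ac)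
  \<comment> \<open>Since \<open>a\<close> is nonincreasing and nonnegative, the first two groups
    are nonpositive. Only \<open>a (x - z)\<close> is singular, and the hypothesis on
    \<open>k\<close> is designed for it.\<close>
  have "Delta z w x = (a (x + z) - a x) - a x + a (x - z)
      + ((x + z) powr l - 2 * x powr l + (x - z) powr l)"
    by (simp add: Delta_def w)
  also have "\<dots> \<le> a (x - z) + 4 * z powr l"
    using a_mono[of x "x + z"] second_difference_powr_le[OF z l] a0[of x] x z by linarith
  also have "\<dots> \<le> a (x - z) + 4 * w z" using a0[of z] by (simp add: w)
  finally have "Delta z w x \<le> a (x - z) + 4 * w z" .
  from mult_right_mono[OF this k]
  have "Delta z w x * k \<le> a (x - z) * k + 4 * (w z * k)" by (simp add: algebra_simps)
  also have "\<dots> \<le> C * (w z * (w x * w y * f)) + 4 * (w z * (w x * w y * f))"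
    using 1 w0 by (intro add_mono 3 mult_left_mono) auto
  also have "\<dots> \<le> (C + 7) * (w z * (w x * w y * f))"
  proof -
    have "C * t + 4 * t \<le> (C + 7) * t" if "0 \<le> t" for t using that by (simp add: distrib_right)
    then show ?thesis using mult_nonneg_nonneg[OF w0[of z] p] by blast
  qed
  finally show "Delta z w x * k \<le> w x * w y * ((C + 7) * w z * f)" by (simp add: mult_ac)
  have "(x + z) powr l \<le> (2 * x) powr l" using x z l by (intro powr_mono2) auto
  also have "\<dots> \<le> 4 * x powr l"
    using powr_mono[of l 2 "2::real"] l x by (simp add: powr_mult powr_numeral)
  finally have "(x + z) powr l \<le> 4 * x powr l" .
  moreover have "(x - z) powr l \<le> x powr l" using x z l by (intro powr_mono2) auto
  moreover have "0 \<le> a x" "0 \<le> x powr l" "a (x + z) \<le> a x"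
    using a_mono[of x "x + z"] x z by (simp_all add: a_def)
  \<comment> \<open>The powers contribute 4 + 2 + 1 = 7 and the nonsingular values of
    \<open>a\<close> only 1 + 2 = 3, so 7 serves for both.\<close>
  ultimately have "w (x + z) + 2 * w x + w (x - z) \<le> a (x - z) + 7 * w x"
    unfolding w by argo
  from mult_right_mono[OF this k]
  have "(w (x + z) + 2 * w x + w (x - z)) * k \<le> a (x - z) * k + 7 * (w x * k)"
    by (simp add: algebra_simps)
  also have "\<dots> \<le> C * (w x * (w x * w y * f)) + 7 * (w x * (w x * w y * f))"
  proof (intro add_mono mult_left_mono 1 w0)
    have "C * (a x * w x * w y * f) \<le> C * (w x * (w x * w y * f))"
      using mult_right_mono[OF aw p] C by (intro mult_left_mono) (auto simp: mult_ac)
    then show "a (x - z) * k \<le> C * (w x * (w x * w y * f))" using 2 by simp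
  qed auto
  also have "\<dots> = (C + 7) * (w x * (w x * w y * f)) * 1" by (simp add: algebra_simps)
  \<comment> \<open>The factor \<open>w z\<close>, at least 1, is inserted so that both estimates
    use the same function of \<open>z\<close>.\<close>
  also have "\<dots> \<le> (C + 7) * (w x * (w x * w y * f)) * w z"
  proof (rule mult_left_mono[OF w1[OF z(1)]])
    show "0 \<le> (C + 7) * (w x * (w x * w y * f))" using C w0[of x] p by simp
  qed
  finally show "(w (x + z) + 2 * w x + w (x - z)) * k \<le> (w x)\<^sup>2 * w y * ((C + 7) * w z * f)"
    by (simp add: power2_eq_square mult_ac)
qed

lemma neg_pow_eq_powr: "0 < x \<Longrightarrow> neg_pow a x = ennreal (x powr (-a))"
  by (simp add: neg_pow_def)

text \<open>Only an inequality, because it is applied to \<open>hat (x - z)\<close>, which is 0 at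
  \<open>z = x\<close>; there \<open>powr\<close> gives 0 and \<open>neg_pow\<close> does
  not.\<close>

lemma powr_le_neg_pow: "0 \<le> a \<Longrightarrow> ennreal (x powr (-a)) \<le> neg_pow a x"
  by (simp add: neg_pow_def)

subsection \<open>Borel representatives\<close>

lemma null_sets_lborel_times_UNIV:
  fixes A :: "'a::euclidean_space set"
  assumes "A \<in> null_sets lborel"
  shows "A \<times> UNIV \<in> null_sets (lborel :: ('a \<times> 'b::euclidean_space) measure)"
    and "UNIV \<times> A \<in> null_sets (lborel :: ('b \<times> 'a::euclidean_space) measure)"
proof -
  have "A \<times> UNIV \<in> null_sets (lborel \<Otimes>\<^sub>M (lborel :: 'b measure))"
    using assms by (intro lborel.times_in_null_sets1) auto
  then show "A \<times> UNIV \<in> null_sets (lborel :: ('a \<times> 'b) measure)" by (simp add: lborel_prod)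
  have "UNIV \<times> A \<in> null_sets ((lborel :: 'b measure) \<Otimes>\<^sub>M lborel)"
    using assms by (intro lborel.times_in_null_sets2) auto
  then show "UNIV \<times> A \<in> null_sets (lborel :: ('b \<times> 'a) measure)" by (simp add: lborel_prod)
qed

lemma AE_lborel_triple:
  fixes P :: "real \<Rightarrow> bool"
  assumes "AE x in lborel. P x"
  shows "AE (x, y, z) in (lborel :: (real \<times> real \<times> real) measure). P x"
    and "AE (x, y, z) in (lborel :: (real \<times> real \<times> real) measure). P y"
    and "AE (x, y, z) in (lborel :: (real \<times> real \<times> real) measure). P z"
proof -
  obtain N where N: "N \<in> null_sets lborel" and PN: "{x. \<not> P x} \<subseteq> N"
    using assms by (auto elim!: AE_E simp: null_sets_def)
  show "AE (x, y, z) in (lborel :: (real \<times> real \<times> real) measure). P x"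
    by (rule AE_I'[OF null_sets_lborel_times_UNIV(1)[OF N]]) (use PN in auto)
  show "AE (x, y, z) in (lborel :: (real \<times> real \<times> real) measure). P y"
    by (rule AE_I'[OF null_sets_lborel_times_UNIV(2)[OF null_sets_lborel_times_UNIV(1)[OF N]]]) (use PN in auto)
  show "AE (x, y, z) in (lborel :: (real \<times> real \<times> real) measure). P z"
    by (rule AE_I'[OF null_sets_lborel_times_UNIV(2)[OF null_sets_lborel_times_UNIV(2)[OF N]]]) (use PN in auto)
qed

text \<open>Provides times arbitrarily close to a given one at which an almost-everywhere bound
  holds.\<close>

lemma AE_lborel_ex_in_interval:
  fixes P :: "real \<Rightarrow> bool"
  assumes "AE x in lborel. P x" "a < b"
  shows "\<exists>x\<in>{a<..<b}. P x"
proof (rule ccontr)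
  assume "\<not> ?thesis"
  then have "AE x in lborel. x \<notin> {a<..<b}"
    using assms(1) by (auto elim!: eventually_mono)
  then have "emeasure lborel {a<..<b} = 0"
    by (subst (asm) AE_iff_null_sets[symmetric]) auto
  then show False using assms(2) by simp
qed

lemma lebesgue_on_borel_representative:
  fixes f :: "'a::euclidean_space \<Rightarrow> real"
  assumes f: "f \<in> borel_measurable (lebesgue_on S)" and S: "S \<in> sets lebesgue"
  obtains g where "g \<in> borel_measurable borel" "AE x in lborel. (if x \<in> S then f x else 0) = g x"
proof -
  have "(\<lambda>x. if x \<in> S then f x else 0) \<in> borel_measurable lebesgue"
    using f S by (simp add: borel_measurable_if)
  from completion_ex_borel_measurable_real[OF this] show thesis
    using that by auto
qed

text \<open>Measurability of the extended \<open>f\<close> follows from \<open>eq\<close>, because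
  Lebesgue measure is complete; both integrals are then compared over the whole space.\<close>

lemma integral_lebesgue_on_AE_eq:
  fixes f g :: "'a::euclidean_space \<Rightarrow> real"
  assumes g [measurable]: "g \<in> borel_measurable borel" and S: "S \<in> sets lebesgue"
    and eq: "AE x in lborel. (if x \<in> S then f x else 0) = g x"
  shows "(LINT x|lebesgue_on S. f x) = (LINT x|lborel. g x)"
proof -
  have gm: "g \<in> borel_measurable lebesgue" using g by (intro measurable_completion) simp
  have eq': "AE x in lebesgue. g x = (if x \<in> S then f x else 0)"
    by (rule AE_completion) (use eq in \<open>auto elim!: eventually_mono\<close>)
  have fm: "(\<lambda>x. if x \<in> S then f x else 0) \<in> borel_measurable lebesgue"
    by (rule borel_measurable_AE[OF gm eq'])
  have ind: "(\<lambda>x. indicat_real S x *\<^sub>R f x) = (\<lambda>x. if x \<in> S then f x else 0)"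
    by (auto simp: indicator_def)
  have "(LINT x|lebesgue_on S. f x) = (LINT x|lebesgue. (if x \<in> S then f x else 0))"
    using S ind by (subst integral_restrict_space) auto
  also have "\<dots> = (LINT x|lebesgue. g x)"
    using eq' by (intro integral_cong_AE gm fm) (auto elim!: eventually_mono)
  also have "\<dots> = (LINT x|lborel. g x)" by (intro integral_completion) simp
  finally show ?thesis .
qed

lemma AE_half_line_iff: "(AE x in half_line. P x) \<longleftrightarrow> (AE x in lborel. 0 < x \<longrightarrow> P x)"
proof -
  have "(AE x in half_line. P x) \<longleftrightarrow> (AE x in lborel. 0 \<le> x \<longrightarrow> P x)"
    by (subst AE_restrict_space_iff) (auto simp: AE_completion_iff)
  also have "\<dots> \<longleftrightarrow> (AE x in lborel. 0 < x \<longrightarrow> P x)"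
  proof
    assume "AE x in lborel. 0 < x \<longrightarrow> P x"
    with AE_lborel_singleton[of "0::real"] show "AE x in lborel. 0 \<le> x \<longrightarrow> P x"
      by eventually_elim auto
  qed (auto elim!: eventually_mono)
  finally show ?thesis .
qed

lemma integral_half_line_AE_eq:
  fixes f g :: "real \<Rightarrow> real"
  assumes g: "g \<in> borel_measurable borel" "\<And>x. x \<le> 0 \<Longrightarrow> g x = 0"
    and eq: "AE x in lborel. 0 < x \<longrightarrow> f x = g x"
  shows "(LINT x|half_line. f x) = (LINT x|lborel. g x)"
proof -
  have "AE x in lborel. (if x \<in> {0..} then f x else 0) = g x"
    using eq AE_lborel_singleton[of "0::real"]
  proof eventually_elim
    case (elim x)
    then show ?case using g(2)[of x] by (cases "0 < x") auto
  qed
  from integral_lebesgue_on_AE_eq[OF g(1) _ this] show ?thesis by simp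
qed

text \<open>The class of \<open>c\<close> has a Borel representative; taking its positive part and
  setting it to zero for \<open>x \<le> 0\<close> changes it only on a null set of the half-line.
  Sign and support conditions then hold at every point.\<close>

lemma Ycone_borel_representative:
  assumes c: "c \<in> Ycone \<beta> r"
  obtains g where "g \<in> borel_measurable borel" "\<forall>x. 0 \<le> g x" "\<forall>x\<le>0. g x = 0"
    "AE x in lborel. 0 < x \<longrightarrow> c x = g x"
    "(\<integral>\<^sup>+x. ennreal ((x powr (-\<beta>) + x powr r) * g x) \<partial>lborel) = Ynorm \<beta> r c"
proof -
  have cm: "c \<in> borel_measurable half_line" and c0: "AE x in half_line. 0 \<le> c x"
    using c by (auto simp: Ycone_def Yspace_def)
  obtain h where h [measurable]: "h \<in> borel_measurable borel"
    and eq: "AE x in lborel. (if x \<in> {0..} then c x else 0) = h x"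
    using lebesgue_on_borel_representative[OF cm] by auto
  define g where "g x = (if 0 < x then max 0 (h x) else 0)" for x
  have g [measurable]: "g \<in> borel_measurable borel" unfolding g_def by measurable
  have g0: "0 \<le> g x" "x \<le> 0 \<Longrightarrow> g x = 0" for x by (auto simp: g_def)
  have gc: "AE x in lborel. 0 < x \<longrightarrow> c x = g x"
    using eq c0[unfolded AE_half_line_iff] by eventually_elim (auto simp: g_def)
  have "Ynorm \<beta> r c = (\<integral>\<^sup>+x. ennreal ((x powr (-\<beta>) + x powr r) * \<bar>c x\<bar>) * indicator {0..} x \<partial>lebesgue)"
    unfolding Ynorm_def by (rule nn_integral_restrict_space) auto
  also have "\<dots> = (\<integral>\<^sup>+x. ennreal ((x powr (-\<beta>) + x powr r) * g x) \<partial>lebesgue)"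
  proof (rule nn_integral_cong_AE, rule AE_completion)
    show "AE x in lborel. ennreal ((x powr (-\<beta>) + x powr r) * \<bar>c x\<bar>) * indicator {0..} x
        = ennreal ((x powr (-\<beta>) + x powr r) * g x)"
      using gc AE_lborel_singleton[of "0::real"]
    proof eventually_elim
      case (elim x)
      then show ?case using g0[of x] by (cases "0 < x") auto
    qed
  qed
  also have "\<dots> = (\<integral>\<^sup>+x. ennreal ((x powr (-\<beta>) + x powr r) * g x) \<partial>lborel)"
    by (rule nn_integral_completion)
  finally show thesis using that[OF g _ _ gc] g0 by simp
qed

lemma time_interval_measurable: "time_interval T \<in> sets borel"
  unfolding time_interval_def by measurable

lemma time_interval_downward:
  assumes "t \<in> time_interval T" "s \<in> {0..t}"
  shows "s \<in> time_interval T"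
proof -
  have "ereal s \<le> ereal t" "ereal t < T" using assms by (auto simp: time_interval_def)
  then have "ereal s < T" by (rule order.strict_trans1)
  then show ?thesis using assms by (simp add: time_interval_def)
qed

section \<open>From weak solutions to paths of Borel representatives\<close>

context exchange_kernel
begin

lemma density_path_mono: "density_path B \<tau> c \<Longrightarrow> B \<le> B' \<Longrightarrow> density_path B' \<tau> c"
  unfolding density_path_def by (meson order_trans)

lemma weak_solution_path:
  fixes Kr :: "real \<Rightarrow> real \<Rightarrow> real \<Rightarrow> real"
  assumes Kr: "AE (x, y, z) in lborel. K (x, y, z) = (if (x, y, z) \<in> D \<and> 0 < x \<and> 0 < y then Kr x y z else 0)"
    and D: "D \<in> sets lebesgue"
    and w_le: "\<And>x. 0 < x \<Longrightarrow> (w x)\<^sup>2 \<le> A * (x powr (-\<beta>) + x powr r)" and A: "0 \<le> A"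
    and sol: "weak_solution Kr T \<beta> r c0 c" and \<tau>: "\<tau> \<in> time_interval T"
  obtains B C where "density_path B \<tau> C"
    and "\<forall>t\<in>{0..\<tau>}. AE x in lborel. 0 < x \<longrightarrow> c t x = C t x"
    and "\<forall>f\<in>borel_measurable borel. \<forall>M. (\<forall>x. \<bar>f x\<bar> \<le> M) \<longrightarrow> (\<forall>t\<in>{0..\<tau>}.
      (LINT x|half_line. f x * (c t x - c0 x)) = integral {0..t} (\<lambda>s. form f (C s) (C s)))"
proof -
  let ?I = "time_interval T"
  note sol = sol[unfolded weak_solution_def]
  note cone = sol[THEN conjunct1, rule_format]
  note cont = sol[THEN conjunct2, THEN conjunct1, rule_format]
  note bounded = sol[THEN conjunct2, THEN conjunct2, THEN conjunct1]
  note weak = sol[THEN conjunct2, THEN conjunct2, THEN conjunct2, THEN conjunct2, rule_format]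
  define R where "R t g \<longleftrightarrow> g \<in> borel_measurable borel \<and> (\<forall>x. 0 \<le> g x) \<and> (\<forall>x\<le>0. g x = 0) \<and>
      (AE x in lborel. 0 < x \<longrightarrow> c t x = g x) \<and>
      (\<integral>\<^sup>+x. ennreal ((x powr (-\<beta>) + x powr r) * g x) \<partial>lborel) = Ynorm \<beta> r (c t)" for t g
  \<comment> \<open>Choosing a representative at each time separately is harmless: time enters only
    through integrals in space, whose continuity comes from convergence in L^1.\<close>
  define C where "C t = (SOME g. R t g)" for t
  have R: "R t (C t)" if t: "t \<in> ?I" for t
  proof (rule Ycone_borel_representative[OF cone[OF t]])
    fix g assume "g \<in> borel_measurable borel" "\<forall>x. 0 \<le> g x" "\<forall>x\<le>0. g x = 0"
      "AE x in lborel. 0 < x \<longrightarrow> c t x = g x"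
      "(\<integral>\<^sup>+x. ennreal ((x powr (-\<beta>) + x powr r) * g x) \<partial>lborel) = Ynorm \<beta> r (c t)"
    then have "R t g" by (simp add: R_def)
    then show ?thesis unfolding C_def by (rule someI[of "R t"])
  qed
  have C: "C t \<in> borel_measurable borel" "0 \<le> C t x" "x \<le> 0 \<Longrightarrow> C t x = 0" if "t \<in> ?I" for t x
    using R[OF that] unfolding R_def by simp_all
  have cC: "AE x in lborel. 0 < x \<longrightarrow> c t x = C t x"
    and normC: "(\<integral>\<^sup>+x. ennreal ((x powr (-\<beta>) + x powr r) * C t x) \<partial>lborel) = Ynorm \<beta> r (c t)"
    if "t \<in> ?I" for t
    using R[OF that] unfolding R_def by blast+
  have nn_le: "(\<integral>\<^sup>+x. ennreal ((w x)\<^sup>2 * \<bar>C t x\<bar>) \<partial>lborel) \<le> ennreal A * Ynorm \<beta> r (c t)"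
    if t: "t \<in> ?I" for t
  proof -
    note [measurable] = C(1)[OF t]
    have "(\<integral>\<^sup>+x. ennreal ((w x)\<^sup>2 * \<bar>C t x\<bar>) \<partial>lborel)
        \<le> (\<integral>\<^sup>+x. ennreal A * ennreal ((x powr (-\<beta>) + x powr r) * C t x) \<partial>lborel)"
    proof (rule nn_integral_mono)
      fix x
      have "(w x)\<^sup>2 * C t x \<le> A * (x powr (-\<beta>) + x powr r) * C t x"
        using w_le[of x] C(2,3)[OF t, of x] by (cases "0 < x") (auto intro!: mult_right_mono)
      then show "ennreal ((w x)\<^sup>2 * \<bar>C t x\<bar>) \<le> ennreal A * ennreal ((x powr (-\<beta>) + x powr r) * C t x)"
        using C(2)[OF t, of x] A by (simp add: ennreal_leI mult.assoc flip: ennreal_mult)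
    qed
    also have "\<dots> = ennreal A * Ynorm \<beta> r (c t)"
      using normC[OF t] by (subst nn_integral_cmult) auto
    finally show ?thesis .
  qed
  have admC: "admissible (C t)" if t: "t \<in> ?I" for t
  proof -
    note [measurable] = C(1)[OF t]
    have "Ynorm \<beta> r (c t) < \<infinity>" using cone[OF t] by (simp add: Ycone_def Yspace_def)
    then have "ennreal A * Ynorm \<beta> r (c t) < \<infinity>" by (simp add: ennreal_mult_less_top)
    then have "(\<integral>\<^sup>+x. ennreal ((w x)\<^sup>2 * \<bar>C t x\<bar>) \<partial>lborel) < \<infinity>"
      using nn_le[OF t] by (rule order.strict_trans1[rotated])
    then have "integrable lborel (\<lambda>x. (w x)\<^sup>2 * \<bar>C t x\<bar>)"
      by (intro integrableI_nonneg) auto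
    then show ?thesis using C[OF t] by (simp add: admissible_def)
  qed
  have L1: "(LINT x|half_line. \<bar>c s x - c t x\<bar>) = (LINT x|lborel. \<bar>C s x - C t x\<bar>)"
    if "s \<in> ?I" "t \<in> ?I" for s t
  proof (rule integral_half_line_AE_eq)
    show "(\<lambda>x. \<bar>C s x - C t x\<bar>) \<in> borel_measurable borel"
      using C(1)[OF that(1)] C(1)[OF that(2)] by measurable
    show "AE x in lborel. 0 < x \<longrightarrow> \<bar>c s x - c t x\<bar> = \<bar>C s x - C t x\<bar>"
      using cC[OF that(1)] cC[OF that(2)] by eventually_elim auto
  qed (use C(3) that in auto)
  have lim: "((\<lambda>s. LINT x|lborel. \<bar>C s x - C t x\<bar>) \<longlongrightarrow> 0) (at t within ?I)" if t: "t \<in> ?I" for t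
  proof -
    show ?thesis
      by (rule Lim_transform_within[OF cont[OF t] zero_less_one]) (use L1 t in auto)
  qed
  obtain B0 where B0: "AE t in lebesgue_on ?I. Ynorm \<beta> r (c t) \<le> ennreal B0"
    using bounded by blast
  define B where "B = A * max 0 B0"
  have good: "AE t in lborel. t \<in> ?I \<longrightarrow> w2norm (C t) \<le> B"
  proof -
    have "AE t in lborel. t \<in> ?I \<longrightarrow> Ynorm \<beta> r (c t) \<le> ennreal B0"
      using B0 time_interval_measurable[of T]
      by (subst (asm) AE_restrict_space_iff) (auto simp: AE_completion_iff)
    then show ?thesis
    proof (rule eventually_mono, intro impI)
      fix t assume *: "t \<in> ?I \<longrightarrow> Ynorm \<beta> r (c t) \<le> ennreal B0" and t: "t \<in> ?I"
      have "ennreal (w2norm (C t)) = (\<integral>\<^sup>+x. ennreal ((w x)\<^sup>2 * \<bar>C t x\<bar>) \<partial>lborel)"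
        unfolding w2norm_def by (rule nn_integral_eq_integral[symmetric]) (auto simp: admissible_integrable admC t)
      also have "\<dots> \<le> ennreal A * Ynorm \<beta> r (c t)" by (rule nn_le[OF t])
      also have "\<dots> \<le> ennreal A * ennreal (max 0 B0)"
        using * t by (intro mult_left_mono) (auto intro: order_trans ennreal_leI)
      also have "\<dots> = ennreal B" using A by (simp add: B_def ennreal_mult)
      finally show "w2norm (C t) \<le> B" using A by (simp add: B_def ennreal_le_iff)
    qed
  qed
  text \<open>The bound holds at every time, not only at almost every time, by lower semicontinuity
    of the weighted norm under convergence in \<open>L\<^sup>1\<close>.\<close>
  have bound: "w2norm (C t) \<le> B" if t: "t \<in> ?I" for t
  proof -
    have "(LINT x|lborel. min ((w x)\<^sup>2) (real n) * \<bar>C t x\<bar>) \<le> B" for n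
    proof (rule field_le_epsilon)
      fix \<epsilon> :: real assume \<epsilon>: "0 < \<epsilon>"
      have "\<forall>\<^sub>F s in at t within ?I. (LINT x|lborel. \<bar>C s x - C t x\<bar>) < \<epsilon> / (real n + 1)"
        using \<epsilon> by (intro order_tendstoD(2)[OF lim[OF t]]) simp
      then obtain \<delta> where \<delta>: "0 < \<delta>" and near: "\<And>s. s \<in> ?I \<Longrightarrow> s \<noteq> t \<Longrightarrow> dist s t < \<delta> \<Longrightarrow>
          (LINT x|lborel. \<bar>C s x - C t x\<bar>) < \<epsilon> / (real n + 1)"
        unfolding eventually_at by blast
      have "ereal t < T" "0 \<le> t" using t by (auto simp: time_interval_def)
      \<comment> \<open>\<open>T\<close> is not attained, so there is room to the right of
        \<open>t\<close>; a time \<open>s\<close> with the good bound is found there within distance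
        \<open>\<delta>\<close>.\<close>
      then obtain b where b: "t < b" "ereal b < T" using ereal_dense2[of "ereal t" T] by auto
      obtain s where s: "t < s" "s < b" "s < t + \<delta>" "s \<in> ?I \<longrightarrow> w2norm (C s) \<le> B"
        using AE_lborel_ex_in_interval[OF good, of t "min b (t + \<delta>)"] b \<delta> by auto
      have "ereal s < T" using s by (intro order.strict_trans[OF _ b(2)]) simp
      then have sI: "s \<in> ?I" using s(1) \<open>0 \<le> t\<close> by (simp add: time_interval_def)
      note [measurable] = C(1)[OF t] C(1)[OF sI]
      note I = admissible_integrable[OF admC[OF t]] admissible_integrable[OF admC[OF sI]]
        admissible_integrable(3)[OF admissible_diff[OF admC[OF sI] admC[OF t]]]
      have tr: "integrable lborel (\<lambda>x. min ((w x)\<^sup>2) (real n) * \<bar>C t x\<bar>)"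
        by (rule Bochner_Integration.integrable_bound[OF I(1)]) (auto simp: abs_mult intro!: mult_right_mono)
      have "(LINT x|lborel. min ((w x)\<^sup>2) (real n) * \<bar>C t x\<bar>)
          \<le> (LINT x|lborel. (w x)\<^sup>2 * \<bar>C s x\<bar> + real n * \<bar>C s x - C t x\<bar>)"
      proof (rule integral_mono[OF tr])
        show "integrable lborel (\<lambda>x. (w x)\<^sup>2 * \<bar>C s x\<bar> + real n * \<bar>C s x - C t x\<bar>)"
          using I by (intro Bochner_Integration.integrable_add integrable_mult_right)
        fix x
        \<comment> \<open>The capped weight is relaxed to \<open>(w x)^2\<close> on
          \<open>C s\<close>, giving its full moment, and to \<open>n\<close> on the difference,
          which is small in L^1.\<close>
        have "min ((w x)\<^sup>2) (real n) * \<bar>C t x\<bar>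
            \<le> min ((w x)\<^sup>2) (real n) * (\<bar>C s x\<bar> + \<bar>C s x - C t x\<bar>)"
          by (intro mult_left_mono) auto
        also have "\<dots> \<le> (w x)\<^sup>2 * \<bar>C s x\<bar> + real n * \<bar>C s x - C t x\<bar>"
          unfolding distrib_left by (intro add_mono mult_right_mono) auto
        finally show "min ((w x)\<^sup>2) (real n) * \<bar>C t x\<bar> \<le> (w x)\<^sup>2 * \<bar>C s x\<bar> + real n * \<bar>C s x - C t x\<bar>" .
      qed
      also have "\<dots> = w2norm (C s) + real n * (LINT x|lborel. \<bar>C s x - C t x\<bar>)"
        unfolding w2norm_def using I by simp
      also have "\<dots> \<le> B + real n * (\<epsilon> / (real n + 1))"
        using s sI less_imp_le[OF near[OF sI]] by (intro add_mono mult_left_mono) (auto simp: dist_real_def)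
      also have "\<dots> \<le> B + \<epsilon>" using \<epsilon> by (simp add: field_simps)
      finally show "(LINT x|lborel. min ((w x)\<^sup>2) (real n) * \<bar>C t x\<bar>) \<le> B + \<epsilon>" .
    qed
    then show ?thesis
      unfolding w2norm_def
      by (intro LIMSEQ_le_const2[OF integral_truncated_weight_tendsto])
        (auto simp: C(1)[OF t] admissible_integrable(1)[OF admC[OF t]])
  qed
  have sub: "{0..\<tau>} \<subseteq> ?I"
    using time_interval_downward[OF \<tau>] by blast
  have density_path: "density_path B \<tau> C"
    unfolding density_path_def
    using admC C(2) bound sub tendsto_within_subset[OF lim sub] by blast
  have weak': "(LINT x|half_line. f x * (c t x - c0 x)) = integral {0..t} (\<lambda>s. form f (C s) (C s))"
    if f: "f \<in> borel_measurable borel" and M: "\<And>x. \<bar>f x\<bar> \<le> M" and t: "t \<in> {0..\<tau>}" for f M t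
  proof -
    have "f \<in> borel_measurable half_line"
      by (intro measurable_restrict_space1 measurable_completion) (use f in simp)
    then have fL: "f \<in> Linfty" using M by (auto simp: Linfty_def)
    have inner: "(LINT (x, y, z)|lebesgue_on D. Delta z f x * kappa Kr (c s) x y z) = form f (C s) (C s)"
      if s: "s \<in> ?I" for s
      unfolding form_def
    proof (rule integral_lebesgue_on_AE_eq[OF form_integrand_measurable[OF f C(1)[OF s] C(1)[OF s]] D])
      \<comment> \<open>Off the null planes \<open>x = 0\<close> and \<open>y = 0\<close>, points of
        \<open>D\<close> have positive \<open>x\<close> and \<open>y\<close>, where \<open>K\<close>
        agrees with \<open>Kr\<close> and both factors \<open>c s\<close> with their
        representative.\<close>
      have "AE x in lborel. x \<noteq> 0 \<and> (0 < x \<longrightarrow> c s x = C s x)"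
        using cC[OF s] AE_lborel_singleton[of "0::real"] by eventually_elim auto
      note ae = AE_lborel_triple[OF this]
      show "AE v in lborel. (if v \<in> D then (case v of (x, y, z) \<Rightarrow> Delta z f x * kappa Kr (c s) x y z) else 0)
          = (case v of (x, y, z) \<Rightarrow> Delta z f x * K (x, y, z) * C s x * C s y)"
        using Kr ae(1) ae(2)
      proof eventually_elim
        case (elim v)
        obtain x y z where v: "v = (x, y, z)" by (cases v)
        show ?case
        proof (cases "v \<in> D")
          case True
          then have "0 < x" "0 < y" using elim by (auto simp: v D_def)
          then show ?thesis using elim True by (simp add: v kappa_def)
        qed (use elim in \<open>simp add: v\<close>)
      qed
    qed
    have "(LINT x|half_line. f x * (c t x - c0 x))
        = (LINT s|lebesgue_on {0..t}. LINT (x, y, z)|lebesgue_on D. Delta z f x * kappa Kr (c s) x y z)"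
      using t sub by (intro weak fL) auto
    also have "\<dots> = (LINT s|lebesgue_on {0..t}. form f (C s) (C s))"
      using t sub by (intro Bochner_Integration.integral_cong refl inner) auto
    \<comment> \<open>Continuity in time identifies the Lebesgue integral with the gauge integral of
      the uniqueness argument.\<close>
    also have "\<dots> = integral {0..t} (\<lambda>s. form f (C s) (C s))"
      using t by (intro lebesgue_integral_eq_integral continuous_imp_integrable_real
          continuous_on_subset[OF density_path_form_continuous[OF f M density_path]]) auto
    finally show ?thesis .
  qed
  show thesis using cC sub by (intro that[OF density_path] ballI allI impI weak') auto
qed

end

section \<open>The given kernel as an instance of the abstract setting\<close>

lemma closed_D: "closed D"
  unfolding D_def case_prod_unfold
  by (intro closed_Collect_conj closed_Collect_le continuous_intros)

theorem theorem1p11: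
  fixes K :: "real \<Rightarrow> real \<Rightarrow> real \<Rightarrow> real"
    and \<alpha> lam :: real and \<phi> c0 :: "real \<Rightarrow> real"
    and T :: ereal and c d :: "real \<Rightarrow> real \<Rightarrow> real"
  assumes K_measurable: "(\<lambda>(x, y, z). K x y z) \<in> borel_measurable octant"
    and K_nonneg: "\<And>x y z. 0 \<le> x \<Longrightarrow> 0 \<le> y \<Longrightarrow> 0 \<le> z \<Longrightarrow> 0 \<le> K x y z"
    and K_sym: "\<And>x y z. 0 \<le> x \<Longrightarrow> 0 \<le> y \<Longrightarrow> 0 \<le> z \<Longrightarrow> K x y z = K y x z"
    and K_zero: "\<And>x y z. 0 \<le> x \<Longrightarrow> 0 \<le> y \<Longrightarrow> 0 \<le> z \<Longrightarrow> z > x \<Longrightarrow> K x y z = 0"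
    and alpha: "0 \<le> \<alpha>"
    and lambda: "1 \<le> lam" "lam \<le> 2"
    and phi: "\<phi> \<in> Ycone \<alpha> lam"
    and K_bound: "\<And>x y z. 0 \<le> x \<Longrightarrow> 0 \<le> y \<Longrightarrow> 0 \<le> z \<Longrightarrow>
        ennreal (K x y z) \<le> neg_pow \<alpha> (hat x) * neg_pow \<alpha> (hat y)
          * ennreal (check x powr lam) * ennreal (check y powr lam) * ennreal (\<phi> z)"
    and K_bound_singular: "\<alpha> > 0 \<Longrightarrow> \<exists>C>0. \<forall>x y z. 0 \<le> z \<longrightarrow> z \<le> x \<longrightarrow> 0 \<le> y \<longrightarrow>
        neg_pow \<alpha> (hat (x - z)) * ennreal (K x y z)
          \<le> ennreal C * neg_pow (2 * \<alpha>) (hat x) * neg_pow \<alpha> (hat y)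
            * ennreal (check x powr lam) * ennreal (check y powr lam) * ennreal (\<phi> z)"
    and c0: "c0 \<in> Ycone (2 * \<alpha>) (2 * lam)"
    and T: "0 < T"
    and c: "weak_solution K T (2 * \<alpha>) (2 * lam) c0 c"
    and d: "weak_solution K T (2 * \<alpha>) (2 * lam) c0 d"
  shows "\<forall>t\<in>time_interval T. AE x in half_line. c t x = d t x"
proof
  fix \<tau> assume \<tau>: "\<tau> \<in> time_interval T"
  obtain C where C: "0 < C" and singular: "\<And>x y z. 0 \<le> z \<Longrightarrow> z \<le> x \<Longrightarrow> 0 \<le> y \<Longrightarrow>
      neg_pow \<alpha> (hat (x - z)) * ennreal (K x y z)
        \<le> ennreal C * neg_pow (2 * \<alpha>) (hat x) * neg_pow \<alpha> (hat y)
          * ennreal (check x powr lam) * ennreal (check y powr lam) * ennreal (\<phi> z)"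
  proof (cases "\<alpha> = 0")
    case True
    \<comment> \<open>At \<open>\<alpha> = 0\<close> every \<open>neg_pow\<close> equals 1, so
      \<open>K_bound\<close> is already the singular bound, with constant 1.\<close>
    show thesis
    proof (rule that[of 1])
      fix x y z :: real assume "0 \<le> z" "z \<le> x" "0 \<le> y"
      then show "neg_pow \<alpha> (hat (x - z)) * ennreal (K x y z)
        \<le> ennreal 1 * neg_pow (2 * \<alpha>) (hat x) * neg_pow \<alpha> (hat y)
          * ennreal (check x powr lam) * ennreal (check y powr lam) * ennreal (\<phi> z)"
        using K_bound[of x y z] by (simp add: neg_pow_def True)
    qed simp
  next
    case False
    then have "0 < \<alpha>" using alpha by simp
    from K_bound_singular[OF this] show thesis by (elim exE conjE) (rule that; blast)
  qed
  obtain p where p [measurable]: "p \<in> borel_measurable borel"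
    and p_nonneg: "\<forall>x. 0 \<le> p x" and p_zero: "\<forall>x\<le>0. p x = 0" and p\<phi>: "AE x in lborel. 0 < x \<longrightarrow> \<phi> x = p x"
    and pn: "(\<integral>\<^sup>+x. ennreal ((x powr (-\<alpha>) + x powr lam) * p x) \<partial>lborel) = Ynorm \<alpha> lam \<phi>"
    by (rule Ycone_borel_representative[OF phi])
  note p0 = p_nonneg[rule_format] p_zero[rule_format]
  have "closed ({0::real..} \<times> {0::real..} \<times> {0::real..})" by (intro closed_Times closed_atLeast)
  then have "{0::real..} \<times> {0::real..} \<times> {0::real..} \<in> sets lebesgue" by simp
  then obtain g where g [measurable]: "g \<in> borel_measurable borel"
    and gK: "AE v in lborel. (if v \<in> {0..} \<times> {0..} \<times> {0..} then (case v of (x, y, z) \<Rightarrow> K x y z) else 0) = g v"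
    using lebesgue_on_borel_representative[OF K_measurable] by blast
  \<comment> \<open>Cutting off to \<open>D\<close> turns the integral over \<open>D\<close> into
    one over the whole space, and excluding the axes avoids the infinite values in the kernel
    bounds. As \<open>g\<close> matches \<open>K\<close> only almost everywhere, the maximum secures
    nonnegativity at every point.\<close>
  define k where "k v = (if v \<in> D \<and> 0 < fst v \<and> 0 < fst (snd v) then max 0 (g v) else 0)" for v
  define w where "w = weight \<alpha> lam"
  define \<Phi> where "\<Phi> z = (C + 7) * w z * p z" for z
  have kK: "AE (x, y, z) in lborel. k (x, y, z) = (if (x, y, z) \<in> D \<and> 0 < x \<and> 0 < y then K x y z else 0)"
    using gK
  proof eventually_elim
    case (elim v)
    obtain x y z where v: "v = (x, y, z)" by (cases v)
    show ?case
      using elim K_nonneg[of x y z] by (auto simp: v k_def D_def)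
  qed
  have w0: "0 \<le> w x" for x by (simp add: w_def weight_nonneg)
  have \<Phi>0: "0 \<le> \<Phi> z" for z using C w0 p0 by (simp add: \<Phi>_def)
  have bounds: "AE (x, y, z) in lborel. k (x, y, z) \<le> w x * w y * \<Phi> z
      \<and> Delta z w x * k (x, y, z) \<le> w x * w y * \<Phi> z
      \<and> (w (x + z) + 2 * w x + w (x - z)) * k (x, y, z) \<le> (w x)\<^sup>2 * w y * \<Phi> z"
  proof -
    have "AE z in lborel. z \<noteq> 0 \<and> (0 < z \<longrightarrow> \<phi> z = p z)"
      using p\<phi> AE_lborel_singleton[of "0::real"] by eventually_elim auto
    from kK AE_lborel_triple(3)[OF this] show ?thesis
    proof eventually_elim
      case (elim v)
      obtain x y z where v: "v = (x, y, z)" by (cases v)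
      show ?case
      proof (cases "(x, y, z) \<in> D \<and> 0 < x \<and> 0 < y")
        case True
        then have xyz: "0 < x" "0 < y" "0 < z" "z \<le> x" and kv: "k (x, y, z) = K x y z" and \<phi>: "\<phi> z = p z"
          using elim by (auto simp: v D_def)
        have h: "0 < hat x" "0 < hat y" using xyz by (auto simp: hat_def)
        have K0: "0 \<le> K x y z" using xyz by (intro K_nonneg) auto
        have "ennreal (K x y z) \<le> ennreal (hat x powr (-\<alpha>) * hat y powr (-\<alpha>) * check x powr lam * check y powr lam * p z)"
          using K_bound[of x y z] xyz h p0(1)[of z] by (simp add: neg_pow_eq_powr \<phi> ennreal_mult)
        then have 1: "K x y z \<le> hat x powr (-\<alpha>) * hat y powr (-\<alpha>) * check x powr lam * check y powr lam * p z"
          using p0(1)[of z] by (subst (asm) ennreal_le_iff) auto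
        have "ennreal (hat (x - z) powr (-\<alpha>) * K x y z) \<le> neg_pow \<alpha> (hat (x - z)) * ennreal (K x y z)"
          using powr_le_neg_pow[OF alpha] K0 by (simp add: ennreal_mult mult_right_mono)
        also have "\<dots> \<le> ennreal (C * hat x powr (-(2 * \<alpha>)) * hat y powr (-\<alpha>) * check x powr lam * check y powr lam * p z)"
          using singular[of z x y] xyz h p0(1)[of z] C by (simp add: neg_pow_eq_powr \<phi> ennreal_mult)
        finally have 2: "hat (x - z) powr (-\<alpha>) * K x y z
            \<le> C * hat x powr (-(2 * \<alpha>)) * hat y powr (-\<alpha>) * check x powr lam * check y powr lam * p z"
          using p0(1)[of z] C by (subst (asm) ennreal_le_iff) auto
        note b = kernel_weight_bounds[OF xyz alpha lambda K0 p0(1) less_imp_le[OF C] 1 2, folded w_def]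
        \<comment> \<open>Both \<open>C + 7\<close> and \<open>w z\<close> are at least 1, so the
          plain bound on \<open>K\<close> can be stated with the same \<open>\<Phi>\<close> as the
          other two.\<close>
        have "1 * p z \<le> (C + 7) * w z * p z"
          using mult_mono[of 1 "C + 7" 1 "w z"] weight_ge_1[OF xyz(3) alpha, of lam] C p0(1)[of z]
          by (intro mult_right_mono) (auto simp: w_def)
        from mult_left_mono[OF this, of "w x * w y"] have "w x * w y * p z \<le> w x * w y * \<Phi> z"
          using w0 by (simp add: \<Phi>_def)
        with b show ?thesis by (simp add: v kv \<Phi>_def)
      next
        case False
        then have "k (x, y, z) = 0" using elim by (auto simp: v)
        then show ?thesis using w0 \<Phi>0 by (simp add: v)
      qed
    qed
  qed
  \<comment> \<open>\<open>w z\<close> is at most twice the weight of the space containing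
    \<open>\<phi>\<close>, whose finite norm therefore controls \<open>\<Phi>\<close>.\<close>
  have \<Phi>_int: "integrable lborel \<Phi>"
  proof -
    have [measurable]: "w \<in> borel_measurable borel" unfolding w_def by measurable
    have "(\<integral>\<^sup>+z. ennreal (\<Phi> z) \<partial>lborel)
        \<le> (\<integral>\<^sup>+z. ennreal (2 * (C + 7)) * ennreal ((z powr (-\<alpha>) + z powr lam) * p z) \<partial>lborel)"
    proof (rule nn_integral_mono)
      fix z
      have "w z * p z \<le> 2 * (z powr (-\<alpha>) + z powr lam) * p z"
        using weight_le[of z lam \<alpha>] p0[of z] lambda by (cases "0 < z") (auto simp: w_def intro!: mult_right_mono)
      from mult_left_mono[OF this, of "C + 7"] C
      have "\<Phi> z \<le> 2 * (C + 7) * ((z powr (-\<alpha>) + z powr lam) * p z)"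
        by (simp add: \<Phi>_def algebra_simps)
      then have "ennreal (\<Phi> z) \<le> ennreal (2 * (C + 7) * ((z powr (-\<alpha>) + z powr lam) * p z))"
        by (rule ennreal_leI)
      also have "\<dots> = ennreal (2 * (C + 7)) * ennreal ((z powr (-\<alpha>) + z powr lam) * p z)"
        using C p0(1)[of z] by (intro ennreal_mult) auto
      finally show "ennreal (\<Phi> z) \<le> ennreal (2 * (C + 7)) * ennreal ((z powr (-\<alpha>) + z powr lam) * p z)" .
    qed
    also have "\<dots> = ennreal (2 * (C + 7)) * Ynorm \<alpha> lam \<phi>"
      by (subst nn_integral_cmult) (auto simp: pn)
    also have "\<dots> < \<infinity>" using phi by (auto simp: Ycone_def Yspace_def ennreal_mult_less_top)
    finally have "(\<integral>\<^sup>+z. ennreal (\<Phi> z) \<partial>lborel) < \<infinity>" .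
    moreover have "\<Phi> \<in> borel_measurable lborel" unfolding \<Phi>_def by measurable
    ultimately show ?thesis using \<Phi>0 by (intro integrableI_nonneg) auto
  qed
  have k_measurable: "k \<in> borel_measurable borel"
  proof -
    have [measurable]: "D \<in> sets borel" using closed_D by simp
    show ?thesis unfolding k_def by measurable
  qed
  interpret exchange_kernel k w \<Phi>
  proof
    show "AE (x, y, z) in lborel. k (x, y, z) \<le> w x * w y * \<Phi> z"
      "AE (x, y, z) in lborel. Delta z w x * k (x, y, z) \<le> w x * w y * \<Phi> z"
      "AE (x, y, z) in lborel. (w (x + z) + 2 * w x + w (x - z)) * k (x, y, z) \<le> (w x)\<^sup>2 * w y * \<Phi> z"
      using bounds by (auto elim!: eventually_mono)
  qed (use k_measurable \<Phi>_int \<Phi>0 w0 weight_ge_1 alpha in \<open>auto simp: k_def w_def\<close>)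
  have w2: "(w x)\<^sup>2 \<le> 4 * (x powr (- (2 * \<alpha>)) + x powr (2 * lam))" if "0 < x" for x
    using weight_square_le[OF that, of lam \<alpha>] lambda by (simp add: w_def)
  have D: "D \<in> sets lebesgue" using closed_D by simp
  obtain Bc cb where cb: "density_path Bc \<tau> cb" "\<forall>t\<in>{0..\<tau>}. AE x in lborel. 0 < x \<longrightarrow> c t x = cb t x"
    and c_weak: "\<forall>f\<in>borel_measurable borel. \<forall>M. (\<forall>x. \<bar>f x\<bar> \<le> M) \<longrightarrow> (\<forall>t\<in>{0..\<tau>}.
      (LINT x|half_line. f x * (c t x - c0 x)) = integral {0..t} (\<lambda>s. form f (cb s) (cb s)))"
    by (rule weak_solution_path[OF kK D w2 _ c \<tau>]) auto
  obtain Bd db where db: "density_path Bd \<tau> db" "\<forall>t\<in>{0..\<tau>}. AE x in lborel. 0 < x \<longrightarrow> d t x = db t x"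
    and d_weak: "\<forall>f\<in>borel_measurable borel. \<forall>M. (\<forall>x. \<bar>f x\<bar> \<le> M) \<longrightarrow> (\<forall>t\<in>{0..\<tau>}.
      (LINT x|half_line. f x * (d t x - c0 x)) = integral {0..t} (\<lambda>s. form f (db s) (db s)))"
    by (rule weak_solution_path[OF kK D w2 _ d \<tau>]) auto
  define B where "B = max Bc Bd"
  have density_path: "density_path B \<tau> cb" "density_path B \<tau> db"
    using density_path_mono[OF cb(1)] density_path_mono[OF db(1)] by (auto simp: B_def)
  \<comment> \<open>Each \<open>\<tau>\<close> is treated as the endpoint of its own compact time
    interval.\<close>
  have \<tau>0: "\<tau> \<in> {0..\<tau>}" using \<tau> by (simp add: time_interval_def)
  have "AE x in lborel. cb \<tau> x = db \<tau> x"
  proof (rule uniqueness[OF density_path _ \<tau>0])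
    fix f :: "real \<Rightarrow> real" and M t
    assume f: "f \<in> borel_measurable borel" and M: "\<And>x. \<bar>f x\<bar> \<le> M" and t: "t \<in> {0..\<tau>}"
    have tI: "t \<in> time_interval T"
      by (rule time_interval_downward[OF \<tau> t])
    have fm: "f \<in> borel_measurable half_line"
      by (intro measurable_restrict_space1 measurable_completion) (use f in simp)
    have int: "integrable half_line (\<lambda>x. f x * (u x - c0 x))" if "u \<in> Ycone (2 * \<alpha>) (2 * lam)" for u
    proof -
      have "integrable half_line (\<lambda>x. M * (u x - c0 x))"
        using that c0 by (intro integrable_mult_right Bochner_Integration.integrable_diff)
          (auto simp: Ycone_def Yspace_def)
      moreover have "\<bar>f x\<bar> \<le> \<bar>M\<bar>" for x using M[of x] by linarith
      moreover have "(\<lambda>x. f x * (u x - c0 x)) \<in> borel_measurable half_line"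
        using that c0 fm by (auto simp: Ycone_def Yspace_def)
      ultimately show ?thesis
        by (elim Bochner_Integration.integrable_bound) (auto simp: abs_mult intro!: mult_right_mono)
    qed
    have cI: "integrable half_line (\<lambda>x. f x * (c t x - c0 x))"
      and dI: "integrable half_line (\<lambda>x. f x * (d t x - c0 x))"
      using c d tI by (auto simp: weak_solution_def intro!: int)
    have "(LINT x|lborel. f x * (cb t x - db t x)) = (LINT x|half_line. f x * (c t x - d t x))"
    proof (rule integral_half_line_AE_eq[symmetric])
      show "(\<lambda>x. f x * (cb t x - db t x)) \<in> borel_measurable borel"
        using f density_pathD(1)[OF density_path(1) t] density_pathD(1)[OF density_path(2) t] by (auto simp: admissible_def)
      show "f x * (cb t x - db t x) = 0" if "x \<le> 0" for x
        using that density_pathD(1)[OF density_path(1) t] density_pathD(1)[OF density_path(2) t] by (simp add: admissible_def)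
      show "AE x in lborel. 0 < x \<longrightarrow> f x * (c t x - d t x) = f x * (cb t x - db t x)"
        using cb(2)[rule_format, OF t] db(2)[rule_format, OF t] by eventually_elim auto
    qed
    \<comment> \<open>The common initial datum is reinserted, so that the two weak formulations can
      be subtracted; \<open>cI\<close> and \<open>dI\<close> justify splitting the integral.\<close>
    also have "\<dots> = (LINT x|half_line. f x * (c t x - c0 x) - f x * (d t x - c0 x))"
      by (simp add: algebra_simps)
    also have "\<dots> = integral {0..t} (\<lambda>s. form f (cb s) (cb s)) - integral {0..t} (\<lambda>s. form f (db s) (db s))"
      by (simp add: Bochner_Integration.integral_diff[OF cI dI] c_weak[rule_format, OF f M t] d_weak[rule_format, OF f M t])
    also have "\<dots> = integral {0..t} (\<lambda>s. form f (cb s) (cb s) - form f (db s) (db s))"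
      using t by (intro Henstock_Kurzweil_Integration.integral_diff[symmetric] integrable_continuous_real
          continuous_on_subset[OF density_path_form_continuous[OF f M density_path(1)]]
          continuous_on_subset[OF density_path_form_continuous[OF f M density_path(2)]]) auto
    finally show "(LINT x|lborel. f x * (cb t x - db t x))
        = integral {0..t} (\<lambda>s. form f (cb s) (cb s) - form f (db s) (db s))" .
  qed
  then show "AE x in half_line. c \<tau> x = d \<tau> x"
    unfolding AE_half_line_iff using cb(2)[rule_format, OF \<tau>0] db(2)[rule_format, OF \<tau>0] by eventually_elim auto
qed

end
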